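(* For $n=2,3,\dots$ the families $\mathcal F_n$ and $\mathcal G_n$ are not functorial.
   Context: A homomorphism $A\to B$ of operator algebras is star-extendible if it is the restriction of a *-homomorphism $C^*(A)\to C^*(B)$ of the generated C*-algebras. $G_n$ is the complete bipartite digraph with digraph algebra $$A(G_n)=\begin{bmatrix}D_n&M_n\\0&D_n\end{bmatrix}\subseteq M_{2n},$$ where $D_n\cong\mathbb C^n$ is the algebra of diagonal matrices. A star-extendible homomorphism $A(G_n)\otimes M_r\to A(G_n)\otimes M_s$ is regular (1-decomposable) if it is a direct sum of star-extendible homomorphisms of multiplicity one, the multiplicity being that of the *-extension $M_{2n}\otimes M_r\to M_{2n}\otimes M_s$. $\mathcal F_n$ is the family of regular unital star-extendible homomorphisms $\phi:A(G_n)\otimes M_r\to A(G_n)\otimes M_s$, $r<s$, which preserve the $2\times2$ block structure, i.e. $\phi=\begin{bmatrix}\phi_1&\phi_{12}\\0&\phi_2\end{bmatrix}$ with $\phi_1,\phi_2:D_n\otimes M_r\to D_n\otimes M_s$ and $\phi_{12}:M_n\otimes M_r\to M_n\otimes M_s$. $\mathcal G_n\subseteq\mathcal F_n$ is the subfamily of those maps whose indecomposable summands are the multiplicity one maps corresponding to automorphisms of the digraph $G_n$, i.e. are inner unitarily equivalent (via unitaries in the self-adjoint part of the range algebra) to maps $e_{ij}\otimes a\mapsto e_{\sigma(i)\sigma(j)}\otimes\iota(a)$ with $\sigma$ a digraph automorphism of $G_n$ and $\iota:M_r\to M_s$ of multiplicity one. A family $\mathcal F$ of maps is functorial if for any two direct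 systems $A_1\to A_2\to\cdots$ and $A'_1\to A'_2\to\cdots$ with maps in $\mathcal F$, and any star-extendible homomorphisms $A_k\to A'_k$, $A'_k\to A_{k+1}$ forming a commuting diagram between the two systems, there are subsequences $(n_k),(m_k)$, $n_1\le m_1<n_2\le m_2<\cdots$, such that the induced crossover maps $A_{n_k}\to A'_{m_k}$ and $A'_{m_k}\to A_{n_{k+1}}$ belong to $\mathcal F$. *)

theory Defs
  imports "Jordan_Normal_Form.Schur_Decomposition" "HOL-Combinatorics.Permutations"
    "HOL-Library.FuncSet"
begin

text \<open>
  Operator algebras are sets of complex matrices, and a map between two of them is a HOL function
  whose values outside the domain algebra are irrelevant: every notion below only inspects it on
  that algebra. Matrix indices start at 0.
\<close>

text \<open>
  In finite dimensions every *-algebra is norm closed, so the C*-algebra generated by a set is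
  the *-algebra it generates.
\<close>

inductive_set cstar_gen :: "complex mat set \<Rightarrow> complex mat set" for A where
  base: "x \<in> A \<Longrightarrow> x \<in> cstar_gen A"
| add: "x \<in> cstar_gen A \<Longrightarrow> y \<in> cstar_gen A \<Longrightarrow> x + y \<in> cstar_gen A"
| smult: "x \<in> cstar_gen A \<Longrightarrow> c \<cdot>\<^sub>m x \<in> cstar_gen A"
| mult: "x \<in> cstar_gen A \<Longrightarrow> y \<in> cstar_gen A \<Longrightarrow> x * y \<in> cstar_gen A"
| adjoint: "x \<in> cstar_gen A \<Longrightarrow> mat_adjoint x \<in> cstar_gen A"

definition star_hom ::
  "complex mat set \<Rightarrow> complex mat set \<Rightarrow> (complex mat \<Rightarrow> complex mat) \<Rightarrow> bool" where
  "star_hom A B \<Phi> \<longleftrightarrow>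
     \<Phi> \<in> A \<rightarrow> B \<and>
     (\<forall>x\<in>A. \<forall>y\<in>A. \<Phi> (x + y) = \<Phi> x + \<Phi> y) \<and>
     (\<forall>c. \<forall>x\<in>A. \<Phi> (c \<cdot>\<^sub>m x) = c \<cdot>\<^sub>m \<Phi> x) \<and>
     (\<forall>x\<in>A. \<forall>y\<in>A. \<Phi> (x * y) = \<Phi> x * \<Phi> y) \<and>
     (\<forall>x\<in>A. \<Phi> (mat_adjoint x) = mat_adjoint (\<Phi> x))"

definition star_extension ::
  "complex mat set \<Rightarrow> complex mat set \<Rightarrow> (complex mat \<Rightarrow> complex mat)
     \<Rightarrow> (complex mat \<Rightarrow> complex mat) \<Rightarrow> bool" where
  "star_extension A B \<phi> \<Phi> \<longleftrightarrow>
     star_hom (cstar_gen A) (cstar_gen B) \<Phi> \<and> (\<forall>x\<in>A. \<Phi> x = \<phi> x)"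

text \<open>
  A star-extendible map is automatically an algebra homomorphism on \<open>A\<close>.
\<close>

definition star_extendible ::
  "complex mat set \<Rightarrow> complex mat set \<Rightarrow> (complex mat \<Rightarrow> complex mat) \<Rightarrow> bool" where
  "star_extendible A B \<phi> \<longleftrightarrow> \<phi> \<in> A \<rightarrow> B \<and> (\<exists>\<Phi>. star_extension A B \<phi> \<Phi>)"

definition unitary_mat :: "nat \<Rightarrow> complex mat \<Rightarrow> bool" where
  "unitary_mat d U \<longleftrightarrow>
     U \<in> carrier_mat d d \<and> mat_adjoint U * U = 1\<^sub>m d \<and> U * mat_adjoint U = 1\<^sub>m d"

text \<open>
  \<open>\<Phi>\<close> is unitarily equivalent to \<open>x \<mapsto> x \<oplus> \<dots> \<oplus> x \<oplus> 0\<close> with \<open>m\<close> copies of \<open>x\<close>, as a map from the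
  N by N matrices to the M by M matrices.
\<close>

definition has_multiplicity ::
  "nat \<Rightarrow> nat \<Rightarrow> nat \<Rightarrow> (complex mat \<Rightarrow> complex mat) \<Rightarrow> bool" where
  "has_multiplicity N M m \<Phi> \<longleftrightarrow>
     (\<exists>U d. M = m * N + d \<and> unitary_mat M U \<and>
        (\<forall>x\<in>carrier_mat N N.
           \<Phi> x = U * diag_block_mat (replicate m x @ [0\<^sub>m d d]) * mat_adjoint U))"

text \<open>
  Tensor products are taken in the index convention \<open>(i, p) \<mapsto> i * r + p\<close> for \<open>p < r\<close>. Thus
  \<open>ampl N A r\<close> is \<open>A \<otimes> M\<^sub>r\<close>, the set of sums of \<open>a\<^sub>p\<^sub>q \<otimes> e\<^sub>p\<^sub>q\<close> with \<open>a\<^sub>p\<^sub>q \<in> A\<close>, for a linear space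
  \<open>A\<close> of N by N matrices.
\<close>

definition kron :: "complex mat \<Rightarrow> complex mat \<Rightarrow> complex mat" where
  "kron a b = mat (dim_row a * dim_row b) (dim_col a * dim_col b)
     (\<lambda>(k, l). a $$ (k div dim_row b, l div dim_col b) * b $$ (k mod dim_row b, l mod dim_col b))"

definition ampl :: "nat \<Rightarrow> complex mat set \<Rightarrow> nat \<Rightarrow> complex mat set" where
  "ampl N A r = {x \<in> carrier_mat (N * r) (N * r).
     \<forall>p<r. \<forall>q<r. mat N N (\<lambda>(i, j). x $$ (i * r + p, j * r + q)) \<in> A}"

definition unit_mat :: "nat \<Rightarrow> nat \<Rightarrow> nat \<Rightarrow> complex mat" where
  "unit_mat N i j = mat N N (\<lambda>(k, l). if k = i \<and> l = j then 1 else 0)"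

definition digraph_alg :: "nat \<Rightarrow> (nat \<times> nat) set \<Rightarrow> complex mat set" where
  "digraph_alg N E = {x \<in> carrier_mat N N. \<forall>i<N. \<forall>j<N. (i, j) \<notin> E \<longrightarrow> x $$ (i, j) = 0}"

definition diag_alg :: "nat \<Rightarrow> complex mat set" where
  "diag_alg n = {x \<in> carrier_mat n n. diagonal_mat x}"

text \<open>
  The edges of the complete bipartite digraph on the vertices \<open>0, \<dots>, 2n - 1\<close>, all loops included,
  as is usual for digraph algebras.
\<close>

definition G_edges :: "nat \<Rightarrow> (nat \<times> nat) set" where
  "G_edges n = {(i, j). i < 2 * n \<and> j < 2 * n \<and> (i = j \<or> i < n \<and> n \<le> j)}"

definition AG :: "nat \<Rightarrow> nat \<Rightarrow> complex mat set" where
  "AG n r = ampl (2 * n) (digraph_alg (2 * n) (G_edges n)) r"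

definition G_automorphism :: "nat \<Rightarrow> (nat \<Rightarrow> nat) \<Rightarrow> bool" where
  "G_automorphism n \<sigma> \<longleftrightarrow>
     \<sigma> permutes {..<2 * n} \<and>
     (\<forall>i<2 * n. \<forall>j<2 * n. (\<sigma> i, \<sigma> j) \<in> G_edges n \<longleftrightarrow> (i, j) \<in> G_edges n)"

definition block_preserving ::
  "nat \<Rightarrow> nat \<Rightarrow> nat \<Rightarrow> (complex mat \<Rightarrow> complex mat) \<Rightarrow> bool" where
  "block_preserving n r s \<phi> \<longleftrightarrow>
     (\<exists>\<phi>1 \<phi>12 \<phi>2.
        \<phi>1 \<in> ampl n (diag_alg n) r \<rightarrow> ampl n (diag_alg n) s \<and>
        \<phi>2 \<in> ampl n (diag_alg n) r \<rightarrow> ampl n (diag_alg n) s \<and>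
        \<phi>12 \<in> carrier_mat (n * r) (n * r) \<rightarrow> carrier_mat (n * s) (n * s) \<and>
        (\<forall>a\<in>ampl n (diag_alg n) r. \<forall>b\<in>carrier_mat (n * r) (n * r). \<forall>c\<in>ampl n (diag_alg n) r.
           \<phi> (four_block_mat a b (0\<^sub>m (n * r) (n * r)) c)
             = four_block_mat (\<phi>1 a) (\<phi>12 b) (0\<^sub>m (n * s) (n * s)) (\<phi>2 c)))"

text \<open>
  The multiplicity of a star-extendible map is that of its extension to the generated C*-algebras,
  and \<open>A(G\<^sub>n) \<otimes> M\<^sub>r\<close> generates all matrices of size \<open>2nr\<close>.
\<close>

definition multiplicity_one ::
  "nat \<Rightarrow> nat \<Rightarrow> nat \<Rightarrow> (complex mat \<Rightarrow> complex mat) \<Rightarrow> bool" where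
  "multiplicity_one n r s \<psi> \<longleftrightarrow>
     \<psi> \<in> AG n r \<rightarrow> AG n s \<and>
     (\<exists>\<Psi>. star_extension (AG n r) (AG n s) \<psi> \<Psi> \<and> has_multiplicity (2 * n * r) (2 * n * s) 1 \<Psi>)"

text \<open>
  A direct sum of maps is a pointwise sum of maps whose ranges are pairwise orthogonal.
\<close>

definition direct_sum_of ::
  "nat \<Rightarrow> nat \<Rightarrow> nat \<Rightarrow> (complex mat \<Rightarrow> complex mat) \<Rightarrow> (complex mat \<Rightarrow> complex mat) list \<Rightarrow> bool" where
  "direct_sum_of n r s \<phi> \<psi>s \<longleftrightarrow>
     (\<forall>i<length \<psi>s. \<forall>j<length \<psi>s. i \<noteq> j \<longrightarrow>
        (\<forall>x\<in>AG n r. \<forall>y\<in>AG n r. (\<psi>s ! i) x * (\<psi>s ! j) y = 0\<^sub>m (2 * n * s) (2 * n * s))) \<and>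
     (\<forall>x\<in>AG n r. \<phi> x = foldr (+) (map (\<lambda>\<psi>. \<psi> x) \<psi>s) (0\<^sub>m (2 * n * s) (2 * n * s)))"

definition regular ::
  "nat \<Rightarrow> nat \<Rightarrow> nat \<Rightarrow> (complex mat \<Rightarrow> complex mat) \<Rightarrow> bool" where
  "regular n r s \<phi> \<longleftrightarrow>
     star_extendible (AG n r) (AG n s) \<phi> \<and>
     (\<exists>\<psi>s. direct_sum_of n r s \<phi> \<psi>s \<and> (\<forall>\<psi>\<in>set \<psi>s. multiplicity_one n r s \<psi>))"

text \<open>
  The unitary \<open>W\<close> ranges over the self-adjoint part \<open>B \<inter> B\<^sup>*\<close> of \<open>B = A(G\<^sub>n) \<otimes> M\<^sub>s\<close>.
\<close>

definition automorphism_type ::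
  "nat \<Rightarrow> nat \<Rightarrow> nat \<Rightarrow> (complex mat \<Rightarrow> complex mat) \<Rightarrow> bool" where
  "automorphism_type n r s \<psi> \<longleftrightarrow>
     (\<exists>\<sigma> \<iota> W.
        G_automorphism n \<sigma> \<and>
        star_hom (carrier_mat r r) (carrier_mat s s) \<iota> \<and> has_multiplicity r s 1 \<iota> \<and>
        unitary_mat (2 * n * s) W \<and> W \<in> AG n s \<and> mat_adjoint W \<in> AG n s \<and>
        (\<forall>(i, j)\<in>G_edges n. \<forall>a\<in>carrier_mat r r.
           \<psi> (kron (unit_mat (2 * n) i j) a)
             = W * kron (unit_mat (2 * n) (\<sigma> i) (\<sigma> j)) (\<iota> a) * mat_adjoint W))"

text \<open>
  A family of maps is a predicate on domain, codomain and map.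
\<close>

definition family_F ::
  "nat \<Rightarrow> complex mat set \<Rightarrow> complex mat set \<Rightarrow> (complex mat \<Rightarrow> complex mat) \<Rightarrow> bool" where
  "family_F n A B \<phi> \<longleftrightarrow>
     (\<exists>r s. 0 < r \<and> r < s \<and> A = AG n r \<and> B = AG n s \<and>
        regular n r s \<phi> \<and> \<phi> (1\<^sub>m (2 * n * r)) = 1\<^sub>m (2 * n * s) \<and> block_preserving n r s \<phi>)"

definition family_G ::
  "nat \<Rightarrow> complex mat set \<Rightarrow> complex mat set \<Rightarrow> (complex mat \<Rightarrow> complex mat) \<Rightarrow> bool" where
  "family_G n A B \<phi> \<longleftrightarrow>
     family_F n A B \<phi> \<and>
     (\<exists>r s \<psi>s. 0 < r \<and> r < s \<and> A = AG n r \<and> B = AG n s \<and> direct_sum_of n r s \<phi> \<psi>s \<and>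
        (\<forall>\<psi>\<in>set \<psi>s. multiplicity_one n r s \<psi> \<and> automorphism_type n r s \<psi>))"

text \<open>
  \<open>link \<phi> i j\<close> is the composition \<open>A\<^sub>i \<rightarrow> \<dots> \<rightarrow> A\<^sub>j\<close> of the connecting maps \<open>\<phi>\<^sub>k : A\<^sub>k \<rightarrow> A\<^sub>k\<^sub>+\<^sub>1\<close>.
\<close>

definition link :: "(nat \<Rightarrow> complex mat \<Rightarrow> complex mat) \<Rightarrow> nat \<Rightarrow> nat \<Rightarrow> complex mat \<Rightarrow> complex mat" where
  "link \<phi> i j = fold \<phi> [i..<j]"

definition functorial ::
  "(complex mat set \<Rightarrow> complex mat set \<Rightarrow> (complex mat \<Rightarrow> complex mat) \<Rightarrow> bool) \<Rightarrow> bool" where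
  "functorial F \<longleftrightarrow>
     (\<forall>A A' \<phi> \<phi>' \<alpha> \<beta>.
        (\<forall>k. F (A k) (A (Suc k)) (\<phi> k)) \<and>
        (\<forall>k. F (A' k) (A' (Suc k)) (\<phi>' k)) \<and>
        (\<forall>k. star_extendible (A k) (A' k) (\<alpha> k)) \<and>
        (\<forall>k. star_extendible (A' k) (A (Suc k)) (\<beta> k)) \<and>
        (\<forall>k. \<forall>x\<in>A k. \<beta> k (\<alpha> k x) = \<phi> k x) \<and>
        (\<forall>k. \<forall>x\<in>A' k. \<alpha> (Suc k) (\<beta> k x) = \<phi>' k x) \<longrightarrow>
        (\<exists>n m :: nat \<Rightarrow> nat.
           (\<forall>k. n k \<le> m k \<and> m k < n (Suc k)) \<and>
           (\<forall>k. F (A (n k)) (A' (m k)) (\<alpha> (m k) \<circ> link \<phi> (n k) (m k))) \<and>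
           (\<forall>k. F (A' (m k)) (A (n (Suc k))) (link \<phi> (Suc (m k)) (n (Suc k)) \<circ> \<beta> (m k)))))"

end

theory Submission
  imports Defs
begin

text \<open>
  Up to inner equivalence, a unital block preserving star-extendible map \<open>A(G\<^sub>n) \<otimes> M\<^sub>s \<rightarrow> A(G\<^sub>n) \<otimes> M\<^sub>s\<^sub>m\<close>
  amounts to a decomposition of the multiplicity space \<open>C\<^sup>m\<close> for every vertex, and it is regular iff
  all these decompositions commute. For a projection \<open>P\<close> of \<open>C\<^sup>m\<close> let the upper vertices 0 and 1 be sent
  to themselves on the range of \<open>P\<close> and be interchanged on its complement; let \<open>R\<close> act in the same way
  on the lower vertices \<open>n\<close> and \<open>n + 1\<close>, and fix all other vertices. Composing two such maps takes tensor
  products of the symmetries \<open>p = 2P - 1\<close> and \<open>r = 2R - 1\<close>. On \<open>C\<^sup>2\<close> choose \<open>p\<close> and \<open>r\<close> anticommuting. Then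
  \<open>p \<otimes> p\<close> and \<open>r \<otimes> r\<close> commute, so that even powers of the map \<open>\<theta>\<close> so obtained are sums of maps given by automorphisms, while for
  odd powers the symmetries still anticommute and the map is not regular. The systems built from \<open>\<theta>\<^sup>2\<close>
  with crossover maps \<open>\<theta>\<close> therefore violate functoriality for both families.
\<close>

section \<open>Matrices and tensor products\<close>

text \<open>Irregularity has to be established against every conceivable decomposition, so an
  invariant is read off from a single edge. Let y be the image of the matrix unit of the edge from
  vertex 0 to vertex n. Multiplying y on the left by e_0 - e_1 of the upper half and on the right by
  its analogue for the lower half gives an element A, and A y^* A is compared with y. For a regular
  map y is a sum of rank one partial isometries on which both signs act by real numbers, so A y^* A
  is y with nonnegative weights and can equal -y only if y = 0. For \<theta> the weights are
  replaced by the square of the product of the two symmetries, which is -1. Each further \<theta>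
  contributes another factor -1, so only the parity of the number of factors counts. A crossover map
  from the first system to the second is an odd power for every choice of subsequences, so passing
  to subsequences cannot repair it. The connecting maps lie in the smaller family and the crossover
  maps lie outside the larger one, so one argument settles both families. The bound
  \<open>2 \<le> n\<close> supplies two vertices to swap in each half.\<close>

lemma mat_adjoint_eq:
  "mat_adjoint A = mat (dim_col A) (dim_row A) (\<lambda>(i, j). cnj (A $$ (j, i)))"
  unfolding mat_adjoint_def by (intro eq_matI) (auto simp: mat_of_rows_def)

lemma dim_mat_adjoint [simp]:
  "dim_row (mat_adjoint A) = dim_col A" "dim_col (mat_adjoint A) = dim_row A"
  by (simp_all add: mat_adjoint_def)

lemma index_mat_adjoint [simp]:
  "i < dim_col A \<Longrightarrow> j < dim_row A \<Longrightarrow> mat_adjoint A $$ (i, j) = cnj (A $$ (j, i))"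
  by (simp add: mat_adjoint_eq)

lemma mat_adjoint_carrier [simp]: "A \<in> carrier_mat n m \<Longrightarrow> mat_adjoint A \<in> carrier_mat m n"
  by (auto intro!: carrier_matI)

lemma mat_adjoint_add:
  "dim_row A = dim_row B \<Longrightarrow> dim_col A = dim_col B \<Longrightarrow>
     mat_adjoint (A + B :: complex mat) = mat_adjoint A + mat_adjoint B"
  by (intro eq_matI) auto

lemma mat_adjoint_mult:
  "dim_col A = dim_row B \<Longrightarrow> mat_adjoint (A * B :: complex mat) = mat_adjoint B * mat_adjoint A"
  by (intro eq_matI) (auto simp: scalar_prod_def mult.commute)

lemma mat_adjoint_mat_adjoint [simp]: "mat_adjoint (mat_adjoint A) = (A :: complex mat)"
  by (intro eq_matI) auto

lemma mat_adjoint_one [simp]: "mat_adjoint (1\<^sub>m n :: complex mat) = 1\<^sub>m n"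
  by (intro eq_matI) auto

lemma mat_adjoint_zero [simp]: "mat_adjoint (0\<^sub>m n m :: complex mat) = 0\<^sub>m m n"
  by (intro eq_matI) auto

lemma mat_adjoint_four_block:
  fixes A B C D :: "complex mat"
  assumes "A \<in> carrier_mat r1 c1" "B \<in> carrier_mat r1 c2"
    "C \<in> carrier_mat r2 c1" "D \<in> carrier_mat r2 c2"
  shows "mat_adjoint (four_block_mat A B C D)
    = four_block_mat (mat_adjoint A) (mat_adjoint C) (mat_adjoint B) (mat_adjoint D)"
  using assms by (intro eq_matI) auto

lemma mult_assoc_dim:
  fixes A B C :: "complex mat"
  assumes "dim_col A = dim_row B" "dim_col B = dim_row C"
  shows "A * B * C = A * (B * C)"
  by (rule assoc_mult_mat[where ?n\<^sub>1.0 = "dim_row A" and ?n\<^sub>2.0 = "dim_row B"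
        and ?n\<^sub>3.0 = "dim_row C" and ?n\<^sub>4.0 = "dim_col C"])
    (use assms in \<open>auto intro: carrier_matI\<close>)

lemma mult_add_dim:
  fixes A B C :: "complex mat"
  assumes "dim_col A = dim_row B" "dim_row C = dim_row B" "dim_col C = dim_col B"
  shows "A * (B + C) = A * B + A * C"
  by (rule mult_add_distrib_mat[where nr = "dim_row A" and n = "dim_row B" and nc = "dim_col B"])
    (use assms in \<open>auto intro: carrier_matI\<close>)

lemma add_mult_dim:
  fixes A B C :: "complex mat"
  assumes "dim_col A = dim_row C" "dim_row A = dim_row B" "dim_col A = dim_col B"
  shows "(A + B) * C = A * C + B * C"
  by (rule add_mult_distrib_mat[where nr = "dim_row A" and n = "dim_row C" and nc = "dim_col C"])
    (use assms in \<open>auto intro: carrier_matI\<close>)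

lemma one_mult_dim: "dim_row A = n \<Longrightarrow> 1\<^sub>m n * A = (A :: complex mat)"
  by (rule left_mult_one_mat[where nc = "dim_col A"]) (auto intro: carrier_matI)

lemma mult_one_dim: "dim_col A = n \<Longrightarrow> A * 1\<^sub>m n = (A :: complex mat)"
  by (rule right_mult_one_mat[where nr = "dim_row A"]) (auto intro: carrier_matI)

lemma zero_mult_dim: "dim_row A = m \<Longrightarrow> 0\<^sub>m n m * A = (0\<^sub>m n (dim_col A) :: complex mat)"
  by (rule left_mult_zero_mat) (auto intro: carrier_matI)

lemma mult_zero_dim: "dim_col A = n \<Longrightarrow> A * 0\<^sub>m n m = (0\<^sub>m (dim_row A) m :: complex mat)"
  by (rule right_mult_zero_mat) (auto intro: carrier_matI)

lemma smult_mult_dim: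
  "dim_col A = dim_row B \<Longrightarrow> (c \<cdot>\<^sub>m A) * B = c \<cdot>\<^sub>m (A * B :: complex mat)"
  by (rule mult_smult_assoc_mat[where nr = "dim_row A" and n = "dim_row B" and nc = "dim_col B"])
    (auto intro: carrier_matI)

lemma mult_smult_dim:
  "dim_col A = dim_row B \<Longrightarrow> A * (c \<cdot>\<^sub>m B) = c \<cdot>\<^sub>m (A * B :: complex mat)"
  by (rule mult_smult_distrib[where nr = "dim_row A" and n = "dim_row B" and nc = "dim_col B"])
    (auto intro: carrier_matI)

lemma dim_kron [simp]:
  "dim_row (kron a b) = dim_row a * dim_row b" "dim_col (kron a b) = dim_col a * dim_col b"
  by (simp_all add: kron_def)

lemma index_kron [simp]:
  "k < dim_row a * dim_row b \<Longrightarrow> l < dim_col a * dim_col b \<Longrightarrow>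
     kron a b $$ (k, l)
       = a $$ (k div dim_row b, l div dim_col b) * b $$ (k mod dim_row b, l mod dim_col b)"
  by (simp add: kron_def)

lemma kron_carrier [simp]:
  "a \<in> carrier_mat n m \<Longrightarrow> b \<in> carrier_mat p q \<Longrightarrow> kron a b \<in> carrier_mat (n * p) (m * q)"
  by (auto simp: kron_def)

lemma div_less_of_less_mult: "(k::nat) < a * b \<Longrightarrow> k div b < a"
  by (simp add: less_mult_imp_div_less)

lemma mod_less_of_less_mult: "(k::nat) < a * b \<Longrightarrow> k mod b < b"
  by (cases "b = 0") auto

lemma mult_add_less_mult: "i < a \<Longrightarrow> j < b \<Longrightarrow> i * b + j < a * (b::nat)"
proof -
  assume "i < a" "j < b"
  then have "i * b + j < Suc i * b" by simp
  also have "\<dots> \<le> a * b" using \<open>i < a\<close> by (intro mult_right_mono) auto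
  finally show ?thesis .
qed

lemma sum_lessThan_mult:
  fixes f :: "nat \<Rightarrow> nat \<Rightarrow> complex"
  shows "(\<Sum>k<a * b. f (k div b) (k mod b)) = (\<Sum>i<a. \<Sum>j<b. f i j)"
proof -
  have "(\<Sum>i<a. \<Sum>j<b. f i j) = (\<Sum>(i, j)\<in>{..<a} \<times> {..<b}. f i j)"
    by (simp add: sum.cartesian_product)
  also have "\<dots> = (\<Sum>k<a * b. f (k div b) (k mod b))"
  proof (rule sum.reindex_bij_witness
      [where i = "\<lambda>k. (k div b, k mod b)" and j = "\<lambda>(i, j). i * b + j"])
    fix p assume "p \<in> {..<a} \<times> {..<b}"
    then show "(case p of (i, j) \<Rightarrow> i * b + j) \<in> {..<a * b}"
      by (auto intro: mult_add_less_mult)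
  qed (auto simp: div_less_of_less_mult mod_less_of_less_mult)
  finally show ?thesis by simp
qed

lemma kron_mult:
  fixes a b c d :: "complex mat"
  assumes "dim_col a = dim_row c" "dim_col b = dim_row d"
  shows "kron a b * kron c d = kron (a * c) (b * d)"
proof (rule eq_matI)
  fix k l assume "k < dim_row (kron (a * c) (b * d))" "l < dim_col (kron (a * c) (b * d))"
  then have k: "k < dim_row a * dim_row b" and l: "l < dim_col c * dim_col d" by auto
  note less = div_less_of_less_mult[OF k] mod_less_of_less_mult[OF k]
    div_less_of_less_mult[OF l] mod_less_of_less_mult[OF l]
  have "(kron a b * kron c d) $$ (k, l) = (\<Sum>t<dim_row c * dim_row d.
      (a $$ (k div dim_row b, t div dim_row d) * b $$ (k mod dim_row b, t mod dim_row d))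
      * (c $$ (t div dim_row d, l div dim_col d) * d $$ (t mod dim_row d, l mod dim_col d)))"
    using k l assms by (simp add: scalar_prod_def lessThan_atLeast0)
  also have "\<dots> = (\<Sum>i<dim_row c. \<Sum>j<dim_row d.
      (a $$ (k div dim_row b, i) * b $$ (k mod dim_row b, j))
      * (c $$ (i, l div dim_col d) * d $$ (j, l mod dim_col d)))"
    by (rule sum_lessThan_mult)
  also have "\<dots> = (a * c) $$ (k div dim_row b, l div dim_col d)
      * (b * d) $$ (k mod dim_row b, l mod dim_col d)"
    using less assms
    by (simp add: scalar_prod_def lessThan_atLeast0 sum_product mult_ac)
  also have "\<dots> = kron (a * c) (b * d) $$ (k, l)" using k l by simp
  finally show "(kron a b * kron c d) $$ (k, l) = kron (a * c) (b * d) $$ (k, l)" .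
qed auto

lemma kron_add_left:
  "dim_row a = dim_row b \<Longrightarrow> dim_col a = dim_col b \<Longrightarrow>
     kron (a + b) c = kron a c + kron b c"
  by (intro eq_matI) (auto simp: algebra_simps div_less_of_less_mult)

lemma kron_add_right:
  "dim_row b = dim_row c \<Longrightarrow> dim_col b = dim_col c \<Longrightarrow>
     kron a (b + c) = kron a b + kron a c"
  by (intro eq_matI) (auto simp: algebra_simps mod_less_of_less_mult)

lemma kron_smult_left: "kron (c \<cdot>\<^sub>m a) b = c \<cdot>\<^sub>m kron a b"
  by (intro eq_matI) (auto simp: div_less_of_less_mult)

lemma kron_smult_right: "kron a (c \<cdot>\<^sub>m b) = c \<cdot>\<^sub>m kron a b"
  by (intro eq_matI) (auto simp: mod_less_of_less_mult)

lemma kron_adjoint: "mat_adjoint (kron a b) = kron (mat_adjoint a) (mat_adjoint b)"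
  by (intro eq_matI) (auto simp: div_less_of_less_mult mod_less_of_less_mult)

lemma kron_one [simp]: "kron (1\<^sub>m a) (1\<^sub>m b) = 1\<^sub>m (a * b)"
  by (intro eq_matI)
    (auto simp: div_less_of_less_mult mod_less_of_less_mult, metis div_mult_mod_eq)

lemma kron_zero_left [simp]: "kron (0\<^sub>m a b) c = 0\<^sub>m (a * dim_row c) (b * dim_col c)"
  by (intro eq_matI) (auto simp: div_less_of_less_mult)

lemma kron_zero_right [simp]: "kron a (0\<^sub>m b c) = 0\<^sub>m (dim_row a * b) (dim_col a * c)"
  by (intro eq_matI) (auto simp: mod_less_of_less_mult)

text \<open>The index convention makes this an equality of matrices, with no reshuffling: a triple
  of indices gets the same position for both bracketings. Iterated ampliations can therefore be
  compared literally, with M_s \<otimes> M_m read as matrices of size \<open>s * m\<close>.\<close>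

lemma kron_assoc: "kron (kron a b) c = kron a (kron b c)"
proof (rule eq_matI)
  fix k l assume "k < dim_row (kron a (kron b c))" "l < dim_col (kron a (kron b c))"
  then have k: "k < dim_row a * dim_row b * dim_row c" and l: "l < dim_col a * dim_col b * dim_col c"
    by (auto simp: mult.assoc)
  have m: "x mod (p * q) div q = x div q mod p" "x mod (p * q) mod q = x mod q"
    "x mod (q * p) mod q = x mod q" if "0 < q" for x p q :: nat
    using that by (simp_all add: mod_mult2_eq mult.commute[of p q])
  have p: "0 < dim_row c" "0 < dim_col c" "0 < dim_row b" "0 < dim_col b"
    using k l by (auto intro: gr0I)
  have "k mod (dim_row b * dim_row c) < dim_row b * dim_row c"
    "l mod (dim_col b * dim_col c) < dim_col b * dim_col c" using p by auto
  then show "kron (kron a b) c $$ (k, l) = kron a (kron b c) $$ (k, l)"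
    using k l div_less_of_less_mult[OF k] div_less_of_less_mult[OF l] p
    by (simp add: mult.assoc m div_mult2_eq[symmetric] mult.commute[of "dim_row c"]
        mult.commute[of "dim_col c"])
qed (auto simp: mult.assoc)

text \<open>The left factor carries the slow index, so its blocks stay contiguous. This is what
  makes the upper and lower halves of the digraph visible as 2 by 2 blocks after any
  ampliation.\<close>

lemma kron_four_block:
  assumes "A \<in> carrier_mat r1 c1" "B \<in> carrier_mat r1 c2"
    "C \<in> carrier_mat r2 c1" "D \<in> carrier_mat r2 c2"
  shows "kron (four_block_mat A B C D) q
    = four_block_mat (kron A q) (kron B q) (kron C q) (kron D q)"
proof (rule eq_matI)
  fix k l
  assume "k < dim_row (four_block_mat (kron A q) (kron B q) (kron C q) (kron D q))"
    "l < dim_col (four_block_mat (kron A q) (kron B q) (kron C q) (kron D q))"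
  then have k: "k < (r1 + r2) * dim_row q" and l: "l < (c1 + c2) * dim_col q"
    using assms by (auto simp: algebra_simps)
  have less: "x div p < r \<longleftrightarrow> x < r * p" if "0 < p" for x r p :: nat
    using that by (simp add: div_less_iff_less_mult)
  have sub: "(x - r * p) div p = x div p - r" "(x - r * p) mod p = x mod p" if "\<not> x < r * p" 
    for x r p :: nat
  proof -
    from that obtain y where "x = y + r * p" by (metis le_add_diff_inverse2 not_le)
    then show "(x - r * p) div p = x div p - r" "(x - r * p) mod p = x mod p"
      by (cases "p = 0"; simp)+
  qed
  have p: "0 < dim_row q" "0 < dim_col q" using k l by (auto intro: gr0I)
  have kl: "k div dim_row q < r1 + r2" "l div dim_col q < c1 + c2"
    using k l by (auto simp: div_less_of_less_mult)
  have lo: "k - r1 * dim_row q < r2 * dim_row q" if "\<not> k < r1 * dim_row q"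
    using k that by (simp add: algebra_simps)
  have lo': "l - c1 * dim_col q < c2 * dim_col q" if "\<not> l < c1 * dim_col q"
    using l that by (simp add: algebra_simps)
  show "kron (four_block_mat A B C D) q $$ (k, l)
      = four_block_mat (kron A q) (kron B q) (kron C q) (kron D q) $$ (k, l)"
    using k l kl assms lo lo' by (auto simp: less[OF p(1)] less[OF p(2)] sub add_mult_distrib)
qed (use assms in \<open>auto simp: add_mult_distrib\<close>)

section \<open>Star homomorphisms and permutation matrices\<close>

lemma star_hom_kron:
  assumes "q \<in> carrier_mat m m" "q * q = q" "mat_adjoint q = q"
  shows "star_hom (carrier_mat N N) (carrier_mat (N * m) (N * m)) (\<lambda>x. kron x q)"
  unfolding star_hom_def using assms
  by (auto simp: kron_add_left kron_smult_left kron_mult kron_adjoint)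

lemma star_hom_conj:
  assumes S: "S \<in> carrier_mat N N" and inv: "mat_adjoint S * S = 1\<^sub>m N"
  shows "star_hom (carrier_mat N N) (carrier_mat N N) (\<lambda>x. S * x * mat_adjoint S)"
proof -
  have d: "dim_row S = N" "dim_col S = N" using S by auto
  have "S * (x * y) * mat_adjoint S = S * x * mat_adjoint S * (S * y * mat_adjoint S)"
    if x: "x \<in> carrier_mat N N" and y: "y \<in> carrier_mat N N" for x y
  proof -
    have "mat_adjoint S * (S * z) = z" if "dim_row z = N" for z
      using that d mult_assoc_dim[of "mat_adjoint S" S z] by (simp add: inv one_mult_dim)
    then show ?thesis using x y d by (simp add: mult_assoc_dim)
  qed
  then show ?thesis
    unfolding star_hom_def using d S
    by (auto simp: mult_add_dim add_mult_dim smult_mult_dim mult_smult_dim mat_adjoint_mult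
        mult_assoc_dim)
qed

lemma star_hom_comp:
  assumes "star_hom A B \<Phi>" "star_hom B C \<Psi>"
  shows "star_hom A C (\<lambda>x. \<Psi> (\<Phi> x))"
  using assms unfolding star_hom_def Pi_iff by simp

lemma cstar_gen_carrier: "x \<in> cstar_gen A \<Longrightarrow> A \<subseteq> carrier_mat N N \<Longrightarrow> x \<in> carrier_mat N N"
  by (induction rule: cstar_gen.induct) auto

text \<open>A *-homomorphism of the ambient matrices serves as its own extension; what remains is
  that it carries \<open>cstar_gen A\<close> into \<open>cstar_gen B\<close>, by induction along the
  generation.\<close>

lemma star_extension_of_star_hom:
  assumes hom: "star_hom (carrier_mat N N) C \<Phi>"
    and A: "A \<subseteq> carrier_mat N N" and AB: "\<Phi> \<in> A \<rightarrow> B"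
  shows "star_extension A B \<Phi> \<Phi>"
proof -
  have "\<Phi> x \<in> cstar_gen B" if "x \<in> cstar_gen A" for x
    using that
  proof induction
    case (base x)
    then show ?case using AB by (auto intro: cstar_gen.base)
  next
    case (add x y)
    then have "\<Phi> (x + y) = \<Phi> x + \<Phi> y"
      using hom cstar_gen_carrier[OF _ A] unfolding star_hom_def by blast
    then show ?case using add by (auto intro: cstar_gen.add)
  next
    case (smult x c)
    then have "\<Phi> (c \<cdot>\<^sub>m x) = c \<cdot>\<^sub>m \<Phi> x"
      using hom cstar_gen_carrier[OF _ A] unfolding star_hom_def by blast
    then show ?case using smult by (auto intro: cstar_gen.smult)
  next
    case (mult x y)
    then have "\<Phi> (x * y) = \<Phi> x * \<Phi> y"
      using hom cstar_gen_carrier[OF _ A] unfolding star_hom_def by blast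
    then show ?case using mult by (auto intro: cstar_gen.mult)
  next
    case (adjoint x)
    then have "\<Phi> (mat_adjoint x) = mat_adjoint (\<Phi> x)"
      using hom cstar_gen_carrier[OF _ A] unfolding star_hom_def by blast
    then show ?case using adjoint by (auto intro: cstar_gen.adjoint)
  qed
  then show ?thesis
    using hom cstar_gen_carrier[OF _ A] unfolding star_extension_def star_hom_def by (simp add: Pi_iff)
qed

section \<open>Entrywise and block descriptions of the algebras\<close>

lemma ampl_zero_pattern:
  assumes "0 < r"
  shows "ampl N {x \<in> carrier_mat N N. \<forall>i<N. \<forall>j<N. Q i j \<longrightarrow> x $$ (i, j) = 0} r
    = {x \<in> carrier_mat (N * r) (N * r).
         \<forall>k<N * r. \<forall>l<N * r. Q (k div r) (l div r) \<longrightarrow> x $$ (k, l) = 0}"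
proof -
  have 1: "x $$ (k, l) = 0"
    if "\<forall>p<r. \<forall>q<r. \<forall>i<N. \<forall>j<N. Q i j \<longrightarrow> x $$ (i * r + p, j * r + q) = 0"
      and kl: "k < N * r" "l < N * r" "Q (k div r) (l div r)" for x :: "complex mat" and k l
    using that(1)[rule_format, of "k mod r" "l mod r" "k div r" "l div r"] kl assms
    by (simp add: div_less_of_less_mult)
  show ?thesis
    unfolding ampl_def using 1 mult_add_less_mult by (auto simp: set_eq_iff)
qed

lemma AG_iff:
  assumes "0 < r"
  shows "x \<in> AG n r \<longleftrightarrow> x \<in> carrier_mat (2 * n * r) (2 * n * r) \<and>
    (\<forall>k<2 * n * r. \<forall>l<2 * n * r. (k div r, l div r) \<notin> G_edges n \<longrightarrow> x $$ (k, l) = 0)"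
  unfolding AG_def digraph_alg_def ampl_zero_pattern[OF assms, of "2 * n" "\<lambda>i j. (i, j) \<notin> G_edges n"]
  by auto

lemma ampl_diag_iff:
  assumes "0 < r"
  shows "x \<in> ampl n (diag_alg n) r \<longleftrightarrow> x \<in> carrier_mat (n * r) (n * r) \<and>
    (\<forall>k<n * r. \<forall>l<n * r. k div r \<noteq> l div r \<longrightarrow> x $$ (k, l) = 0)"
proof -
  have "diag_alg n = {x \<in> carrier_mat n n. \<forall>i<n. \<forall>j<n. i \<noteq> j \<longrightarrow> x $$ (i, j) = 0}"
    by (auto simp: diag_alg_def diagonal_mat_def)
  then show ?thesis
    using ampl_zero_pattern[OF assms, of n "\<lambda>i j. i \<noteq> j"] by auto
qed

text \<open>Inside a half the only edges are loops, all edges lead from the upper to the lower half,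
  and none lead back. Hence block diagonal corners, a full upper right corner and a zero lower left
  one.\<close>

lemma AG_four_block:
  assumes "0 < r"
  shows "x \<in> AG n r \<longleftrightarrow> (\<exists>a\<in>ampl n (diag_alg n) r. \<exists>b\<in>carrier_mat (n * r) (n * r).
    \<exists>c\<in>ampl n (diag_alg n) r. x = four_block_mat a b (0\<^sub>m (n * r) (n * r)) c)"
    (is "_ \<longleftrightarrow> ?R")
proof
  have upper: "k div r < n \<longleftrightarrow> k < n * r" for k
    using assms by (simp add: div_less_iff_less_mult)
  have lower: "(n * r + k) div r = n + k div r" for k
    using assms by simp
  have edge: "(i, j) \<in> G_edges n \<longleftrightarrow> i < 2 * n \<and> j < 2 * n \<and> (i = j \<or> i < n \<and> n \<le> j)" for i j
    by (simp add: G_edges_def)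
  have two: "k div r < 2 * n" if "k < 2 * n * r" for k
    using that div_less_of_less_mult by simp
  {
    assume x: "x \<in> AG n r"
    define a where "a = mat (n * r) (n * r) (\<lambda>(k, l). x $$ (k, l))"
    define b where "b = mat (n * r) (n * r) (\<lambda>(k, l). x $$ (k, n * r + l))"
    define c where "c = mat (n * r) (n * r) (\<lambda>(k, l). x $$ (n * r + k, n * r + l))"
    have xc: "x \<in> carrier_mat (2 * n * r) (2 * n * r)"
      and x0: "\<And>k l. k < 2 * n * r \<Longrightarrow> l < 2 * n * r \<Longrightarrow> (k div r, l div r) \<notin> G_edges n \<Longrightarrow>
        x $$ (k, l) = 0"
      using x AG_iff[OF assms] by auto
    have "x $$ (k, l) = 0" "x $$ (n * r + k, n * r + l) = 0"
      if "k < n * r" "l < n * r" "k div r \<noteq> l div r" for k l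
    proof -
      have "l div r < n" using that upper by simp
      then have "(k div r, l div r) \<notin> G_edges n"
        "((n * r + k) div r, (n * r + l) div r) \<notin> G_edges n"
        unfolding lower using that by (auto simp: edge)
      then show "x $$ (k, l) = 0" "x $$ (n * r + k, n * r + l) = 0"
        using that by (auto intro!: x0)
    qed
    then have "a \<in> ampl n (diag_alg n) r" "c \<in> ampl n (diag_alg n) r"
      by (auto simp: ampl_diag_iff[OF assms] a_def c_def)
    moreover have "x = four_block_mat a b (0\<^sub>m (n * r) (n * r)) c"
    proof (rule eq_matI)
      fix k l
      assume "k < dim_row (four_block_mat a b (0\<^sub>m (n * r) (n * r)) c)"
        "l < dim_col (four_block_mat a b (0\<^sub>m (n * r) (n * r)) c)"
      then have kl: "k < 2 * n * r" "l < 2 * n * r" by (auto simp: a_def c_def)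
      have "x $$ (k, l) = 0" if "\<not> k < n * r" "l < n * r"
      proof (rule x0[OF kl])
        have "\<not> k div r < n" "l div r < n" using that upper by auto
        then show "(k div r, l div r) \<notin> G_edges n" by (auto simp: edge)
      qed
      then show "x $$ (k, l) = four_block_mat a b (0\<^sub>m (n * r) (n * r)) c $$ (k, l)"
        using kl by (auto simp: a_def b_def c_def)
    qed (use xc in \<open>auto simp: a_def c_def\<close>)
    moreover have "b \<in> carrier_mat (n * r) (n * r)" by (simp add: b_def)
    ultimately show ?R by blast
  }
  assume ?R
  then obtain a b c where abc: "a \<in> ampl n (diag_alg n) r" "b \<in> carrier_mat (n * r) (n * r)"
    "c \<in> ampl n (diag_alg n) r" and x: "x = four_block_mat a b (0\<^sub>m (n * r) (n * r)) c" by blast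
  have ac: "a \<in> carrier_mat (n * r) (n * r)" "c \<in> carrier_mat (n * r) (n * r)"
    and z: "\<And>k l. k < n * r \<Longrightarrow> l < n * r \<Longrightarrow> k div r \<noteq> l div r \<Longrightarrow> a $$ (k, l) = 0 \<and> c $$ (k, l) = 0"
    using abc by (auto simp: ampl_diag_iff[OF assms])
  have "x $$ (k, l) = 0"
    if kl: "k < 2 * n * r" "l < 2 * n * r" and e: "(k div r, l div r) \<notin> G_edges n" for k l
  proof -
    have ne: "k div r \<noteq> l div r" using e two[OF kl(1)] by (auto simp: edge)
    consider "k < n * r" "l < n * r" | "k < n * r" "\<not> l < n * r" | "\<not> k < n * r" "l < n * r"
      | "\<not> k < n * r" "\<not> l < n * r" by blast
    then show ?thesis
    proof cases
      case 1
      then show ?thesis using z[of k l] ne ac by (simp add: x)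
    next
      case 2
      then have "k div r < n" "\<not> l div r < n" using upper by auto
      then show ?thesis using e two kl by (auto simp: edge)
    next
      case 3
      then show ?thesis using ac kl by (simp add: x)
    next
      case 4
      then obtain k' l' where k': "k = n * r + k'" "l = n * r + l'"
        by (metis le_add_diff_inverse not_le)
      then have "c $$ (k', l') = 0" using z[of k' l'] ne kl lower by auto
      then show ?thesis using ac kl k' by (simp add: x)
    qed
  qed
  then show "x \<in> AG n r"
    using ac unfolding AG_iff[OF assms] by (auto simp: x)
qed

section \<open>Permutation unitaries and maps of multiplicity one\<close>

definition perm_mat :: "nat \<Rightarrow> (nat \<Rightarrow> nat) \<Rightarrow> complex mat" where
  "perm_mat N \<pi> = mat N N (\<lambda>(i, j). if i = \<pi> j then 1 else 0)"

lemma dim_perm_mat [simp]: "dim_row (perm_mat N \<pi>) = N" "dim_col (perm_mat N \<pi>) = N"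
  by (simp_all add: perm_mat_def)

lemma perm_mat_carrier [simp]: "perm_mat N \<pi> \<in> carrier_mat N N"
  by (simp add: perm_mat_def)

text \<open>\<open>\<pi>\<close> and \<open>\<rho>\<close> are required to be mutually inverse below
  \<open>N\<close> only, so index formulas in div and mod qualify directly. The column action is
  obtained from the row action by taking adjoints.\<close>

lemma perm_mat_conj:
  assumes inv: "\<And>i j. i < N \<Longrightarrow> j < N \<Longrightarrow> i = \<pi> j \<longleftrightarrow> j = \<rho> i" and bound: "\<And>i. i < N \<Longrightarrow> \<rho> i < N"
    and A: "A \<in> carrier_mat N N"
  shows "perm_mat N \<pi> * A * mat_adjoint (perm_mat N \<pi>) = mat N N (\<lambda>(i, j). A $$ (\<rho> i, \<rho> j))"
proof -
  have row: "(perm_mat N \<pi> * B) $$ (i, j) = B $$ (\<rho> i, j)"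
    if "i < N" "j < N" "B \<in> carrier_mat N N" for i j B
  proof -
    have "(perm_mat N \<pi> * B) $$ (i, j) = (\<Sum>t<N. if t = \<rho> i then B $$ (t, j) else 0)"
      using that inv bound[OF that(1)]
      by (simp add: perm_mat_def scalar_prod_def lessThan_atLeast0 if_distrib[of "\<lambda>c. c * _"]
          cong: if_cong)
    then show ?thesis using bound[OF that(1)] by simp
  qed
  have "(A * mat_adjoint (perm_mat N \<pi>)) $$ (i, j) = A $$ (i, \<rho> j)" if "i < N" "j < N" for i j
  proof -
    have "A * mat_adjoint (perm_mat N \<pi>) = mat_adjoint (perm_mat N \<pi> * mat_adjoint A)"
      using A by (simp add: mat_adjoint_mult)
    then show ?thesis
      using row[of j i "mat_adjoint A"] that A bound by simp
  qed
  moreover have "A * mat_adjoint (perm_mat N \<pi>) \<in> carrier_mat N N" using A by auto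
  ultimately show "perm_mat N \<pi> * A * mat_adjoint (perm_mat N \<pi>) = mat N N (\<lambda>(i, j). A $$ (\<rho> i, \<rho> j))"
    using A row[of _ _ "A * mat_adjoint (perm_mat N \<pi>)"] bound
    by (intro eq_matI) (auto simp: mult_assoc_dim)
qed

lemma unitary_matI:
  assumes "U \<in> carrier_mat N N" "U * mat_adjoint U = 1\<^sub>m N"
  shows "unitary_mat N U"
  using assms mat_mult_left_right_inverse[of U N "mat_adjoint U"] by (auto simp: unitary_mat_def)

lemma unitary_perm_mat:
  assumes inv: "\<And>i j. i < N \<Longrightarrow> j < N \<Longrightarrow> i = \<pi> j \<longleftrightarrow> j = \<rho> i" and bound: "\<And>i. i < N \<Longrightarrow> \<rho> i < N"
  shows "unitary_mat N (perm_mat N \<pi>)"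
proof (rule unitary_matI)
  have "perm_mat N \<pi> * mat_adjoint (perm_mat N \<pi>) = mat N N (\<lambda>(i, j). 1\<^sub>m N $$ (\<rho> i, \<rho> j))"
    using perm_mat_conj[OF assms, of "1\<^sub>m N"] by (simp add: mult_one_dim)
  also have "\<dots> = 1\<^sub>m N"
    using inv bound by (intro eq_matI) (auto, metis)
  finally show "perm_mat N \<pi> * mat_adjoint (perm_mat N \<pi>) = 1\<^sub>m N" .
qed simp

lemma unitary_mat_mult:
  assumes "unitary_mat N U" "unitary_mat N V"
  shows "unitary_mat N (U * V)"
proof (rule unitary_matI)
  have d: "U \<in> carrier_mat N N" "V \<in> carrier_mat N N" and
    u: "U * mat_adjoint U = 1\<^sub>m N" "V * mat_adjoint V = 1\<^sub>m N"
    using assms by (auto simp: unitary_mat_def)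
  have "V * (mat_adjoint V * mat_adjoint U) = mat_adjoint U"
    using d mult_assoc_dim[of V "mat_adjoint V" "mat_adjoint U"] by (auto simp: u one_mult_dim)
  then show "U * V * mat_adjoint (U * V) = 1\<^sub>m N"
    using d u by (auto simp: mat_adjoint_mult mult_assoc_dim)
  show "U * V \<in> carrier_mat N N" using d by auto
qed

lemma unitary_mat_kron:
  assumes "unitary_mat N U" "unitary_mat m V"
  shows "unitary_mat (N * m) (kron U V)"
  using assms by (intro unitary_matI) (auto simp: unitary_mat_def kron_adjoint kron_mult)

text \<open>Tensoring with \<open>unit_mat m 0 0\<close> spreads \<open>x\<close> over the positions
  divisible by \<open>m\<close>; a shuffle gathers them into the top left corner, giving x \<oplus>
  0. The unitaries \<open>S\<close> and \<open>\<Omega>\<close> are then absorbed into the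
  conjugating unitary.\<close>

lemma has_multiplicity_kron:
  assumes S: "unitary_mat N S" and \<Omega>: "unitary_mat m \<Omega>" and m: "0 < m"
  shows "has_multiplicity N (N * m) 1
    (\<lambda>x. kron (S * x * mat_adjoint S) (\<Omega> * unit_mat m 0 0 * mat_adjoint \<Omega>))"
proof -
  \<comment> \<open>\<open>\<pi>\<close> interchanges the two tensor factors: position c * N + i,
    with copy number c, goes to i * m + c, and \<open>\<rho>\<close> is the inverse. Copy 0 occupies
    the first \<open>N\<close> positions, and the other m - 1 copies make up the zero block of size
    \<open>d\<close>.\<close>
  define \<pi> \<rho> where "\<pi> = (\<lambda>j. j mod N * m + j div N)" and "\<rho> = (\<lambda>i. i mod m * N + i div m)"
  define d where "d = N * (m - 1)"
  have M: "N * m = 1 * N + d" using m by (cases m) (auto simp: d_def)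
  have \<rho>_less: "\<rho> i < N * m" if "i < N * m" for i
  proof -
    have "i mod m < m" "i div m < N" using that m by (auto simp: div_less_of_less_mult)
    then show ?thesis
      using mult_add_less_mult[of "i mod m" m "i div m" N] by (simp add: \<rho>_def mult.commute)
  qed
  have inv: "i = \<pi> j \<longleftrightarrow> j = \<rho> i" if "i < N * m" "j < N * m" for i j
  proof -
    have "0 < N" using that by (auto intro: gr0I)
    moreover have "j div N < m" "i div m < N"
      using that by (auto simp: div_less_of_less_mult mult.commute)
    ultimately show ?thesis using m by (auto simp: \<pi>_def \<rho>_def)
  qed
  have low: "\<rho> i < N \<longleftrightarrow> i mod m = 0" "i mod m = 0 \<Longrightarrow> \<rho> i = i div m" if "i < N * m" for i
  proof -
    have "i div m < N" using that by (simp add: div_less_of_less_mult)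
    then show "\<rho> i < N \<longleftrightarrow> i mod m = 0" "i mod m = 0 \<Longrightarrow> \<rho> i = i div m"
      by (cases "i mod m"; simp add: \<rho>_def)+
  qed
  define P where "P = perm_mat (N * m) \<pi>"
  define D where "D = (\<lambda>x :: complex mat. diag_block_mat (replicate 1 x @ [0\<^sub>m d d]))"
  have Sc: "S \<in> carrier_mat N N" "\<Omega> \<in> carrier_mat m m" using assms by (auto simp: unitary_mat_def)
  have D: "D x = four_block_mat x (0\<^sub>m N d) (0\<^sub>m d N) (0\<^sub>m d d)" if "x \<in> carrier_mat N N" for x
    using that by (auto simp: D_def)
  have "kron x (unit_mat m 0 0) = P * D x * mat_adjoint P" if x: "x \<in> carrier_mat N N" for x
  proof -
    have Dc: "D x \<in> carrier_mat (N * m) (N * m)"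
      unfolding D[OF x] M using x by auto
    have "P * D x * mat_adjoint P = mat (N * m) (N * m) (\<lambda>(i, j). D x $$ (\<rho> i, \<rho> j))"
      unfolding P_def by (rule perm_mat_conj[OF inv \<rho>_less Dc])
    also have "\<dots> = kron x (unit_mat m 0 0)"
    proof (rule eq_matI)
      fix i j assume "i < dim_row (kron x (unit_mat m 0 0))" "j < dim_col (kron x (unit_mat m 0 0))"
      then have ij: "i < N * m" "j < N * m" using x by (auto simp: unit_mat_def)
      have "\<rho> i < N + d" "\<rho> j < N + d" using \<rho>_less[OF ij(1)] \<rho>_less[OF ij(2)] M by auto
      then have "D x $$ (\<rho> i, \<rho> j) = (if i mod m = 0 \<and> j mod m = 0 then x $$ (i div m, j div m) else 0)"
        using x low[OF ij(1)] low[OF ij(2)] by (auto simp: D)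
      then show "mat (N * m) (N * m) (\<lambda>(i, j). D x $$ (\<rho> i, \<rho> j)) $$ (i, j)
          = kron x (unit_mat m 0 0) $$ (i, j)"
        using ij x m by (auto simp: unit_mat_def)
    qed (use x in \<open>auto simp: unit_mat_def\<close>)
    finally show ?thesis ..
  qed
  note shuffle = this
  have "kron (S * x * mat_adjoint S) (\<Omega> * unit_mat m 0 0 * mat_adjoint \<Omega>)
      = kron S \<Omega> * P * D x * mat_adjoint (kron S \<Omega> * P)" if x: "x \<in> carrier_mat N N" for x
  proof -
    have u: "dim_row (unit_mat m 0 0) = m" "dim_col (unit_mat m 0 0) = m" by (auto simp: unit_mat_def)
    have Dc: "dim_row (D x) = N * m" "dim_col (D x) = N * m"
      unfolding D[OF x] using x M by auto
    have "kron (S * x * mat_adjoint S) (\<Omega> * unit_mat m 0 0 * mat_adjoint \<Omega>)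
        = kron S \<Omega> * kron x (unit_mat m 0 0) * mat_adjoint (kron S \<Omega>)"
      using Sc x u by (auto simp: kron_mult kron_adjoint)
    also have "kron x (unit_mat m 0 0) = P * D x * mat_adjoint P" using x by (rule shuffle)
    finally show ?thesis
      using Sc Dc by (auto simp: mat_adjoint_mult mult_assoc_dim P_def)
  qed
  moreover have "unitary_mat (N * m) (kron S \<Omega> * P)"
    unfolding P_def
    by (rule unitary_mat_mult[OF unitary_mat_kron[OF S \<Omega>] unitary_perm_mat[OF inv \<rho>_less]])
  ultimately show ?thesis
    unfolding has_multiplicity_def D_def
    by (intro exI[of _ "kron S \<Omega> * P"] exI[of _ d] conjI ballI M) simp_all
qed

section \<open>The maps given by two projections\<close>

lemma zero_add_dim: "dim_row A = n \<Longrightarrow> dim_col A = m \<Longrightarrow> 0\<^sub>m n m + A = (A :: complex mat)"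
  by (rule left_add_zero_mat) (auto intro: carrier_matI)

lemma add_zero_dim: "dim_row A = n \<Longrightarrow> dim_col A = m \<Longrightarrow> A + 0\<^sub>m n m = (A :: complex mat)"
  by (rule right_add_zero_mat) (auto intro: carrier_matI)

definition projection :: "nat \<Rightarrow> complex mat \<Rightarrow> bool" where
  "projection m P \<longleftrightarrow> P \<in> carrier_mat m m \<and> P * P = P \<and> mat_adjoint P = P"

abbreviation compl :: "complex mat \<Rightarrow> complex mat" where
  "compl P \<equiv> 1\<^sub>m (dim_row P) - P"

lemma add_compl: "P \<in> carrier_mat m m \<Longrightarrow> P + compl P = (1\<^sub>m m :: complex mat)"
  by (intro eq_matI) auto

lemma compl_eqI:
  "P \<in> carrier_mat m m \<Longrightarrow> P' \<in> carrier_mat m m \<Longrightarrow> P + P' = 1\<^sub>m m \<Longrightarrow> compl P = (P' :: complex mat)"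
  by (drule sym) (intro eq_matI; simp)

lemma
  assumes "projection m P"
  shows compl_projection: "projection m (compl P)"
    and mult_compl: "P * compl P = 0\<^sub>m m m"
    and compl_mult: "compl P * P = 0\<^sub>m m m"
proof -
  have P: "P \<in> carrier_mat m m" "P * P = P" "mat_adjoint P = P"
    using assms by (auto simp: projection_def)
  have d: "dim_row P = m" "dim_col P = m" using P by auto
  show 1: "P * compl P = 0\<^sub>m m m"
    using P mult_minus_distrib_mat[of P m m "1\<^sub>m m" m P] by (simp add: mult_one_dim)
  show 2: "compl P * P = 0\<^sub>m m m"
    using P minus_mult_distrib_mat[of "1\<^sub>m m" m m P P m] by (simp add: one_mult_dim)
  have "compl P - 0\<^sub>m m m = compl P"
    using d by (intro eq_matI) auto
  then have "compl P * compl P = compl P"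
    using P d minus_mult_distrib_mat[of "1\<^sub>m m" m m P "compl P" m] 1
    by (auto simp: one_mult_dim minus_carrier_mat)
  moreover have "cnj (P $$ (i, j)) = P $$ (j, i)" if "i < m" "j < m" for i j
    using arg_cong[OF P(3), of "\<lambda>A. A $$ (j, i)"] that d by simp
  then have "mat_adjoint (compl P) = compl P"
    using d by (intro eq_matI) auto
  ultimately show "projection m (compl P)" using P by (auto simp: projection_def)
qed

section \<open>Vertex swaps controlled by a projection\<close>

definition swap_mat :: "nat \<Rightarrow> complex mat" where
  "swap_mat n = perm_mat n (transpose 0 1)"

lemma dim_swap_mat [simp]: "dim_row (swap_mat n) = n" "dim_col (swap_mat n) = n"
  by (simp_all add: swap_mat_def)

lemma swap_mat_carrier [simp]: "swap_mat n \<in> carrier_mat n n"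
  by (simp add: swap_mat_def)

lemma transpose_less: "a < n \<Longrightarrow> b < n \<Longrightarrow> i < n \<Longrightarrow> transpose a b i < (n::nat)"
  by (auto simp: transpose_def)

lemma transpose_eq_flip: "i = transpose a b j \<longleftrightarrow> j = transpose a b i"
  by (auto simp: transpose_def)

lemma swap_mat_adjoint [simp]: "mat_adjoint (swap_mat n) = swap_mat n"
  by (intro eq_matI) (auto simp: swap_mat_def perm_mat_def transpose_def)

text \<open>Both 0 and 1 must be indices: for \<open>n = 1\<close> the only column would point
  outside the matrix and \<open>swap_mat\<close> would vanish.\<close>

lemma swap_mat_square:
  assumes "2 \<le> n"
  shows "swap_mat n * swap_mat n = 1\<^sub>m n"
proof -
  have "unitary_mat n (swap_mat n)"
    unfolding swap_mat_def using assms
    by (intro unitary_perm_mat[of n _ "transpose 0 1"] transpose_eq_flip transpose_less) auto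
  then show ?thesis by (simp add: unitary_mat_def)
qed

lemma kron_perm_mat_one:
  assumes "0 < s"
  shows "kron (perm_mat N \<sigma>) (1\<^sub>m s) = perm_mat (N * s) (\<lambda>k. \<sigma> (k div s) * s + k mod s)"
proof -
  have "k = \<sigma> (l div s) * s + l mod s \<longleftrightarrow> k div s = \<sigma> (l div s) \<and> k mod s = l mod s" for k l
    using assms by (metis div_mult_mod_eq div_mult_self3 less_irrefl mod_div_trivial mod_mult_self3
        add_cancel_right_right mod_mod_trivial)
  then show ?thesis
    by (intro eq_matI)
      (auto simp: perm_mat_def div_less_of_less_mult mod_less_of_less_mult)
qed

text \<open>Conjugation permutes the s by s blocks along the diagonal, and the induced map on block
  numbers is injective, so entries off the block diagonal remain zero.\<close>

lemma ampl_diag_swap: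
  assumes n: "2 \<le> n" and s: "0 < s" and a: "a \<in> ampl n (diag_alg n) s"
  shows "kron (swap_mat n) (1\<^sub>m s) * a * kron (swap_mat n) (1\<^sub>m s) \<in> ampl n (diag_alg n) s"
proof -
  let ?\<tau> = "\<lambda>k. transpose 0 1 (k div s) * s + k mod s"
  have X: "kron (swap_mat n) (1\<^sub>m s) = perm_mat (n * s) ?\<tau>"
    unfolding swap_mat_def by (rule kron_perm_mat_one[OF s])
  have inv: "k = ?\<tau> l \<longleftrightarrow> l = ?\<tau> k" for k l
  proof -
    have "?\<tau> (?\<tau> k) = k" for k using s by (simp add: mod_less_divisor)
    then show ?thesis by metis
  qed
  have bound: "?\<tau> k < n * s" if "k < n * s" for k
  proof -
    have "transpose 0 1 (k div s) < n"
      using that n by (intro transpose_less) (auto simp: div_less_of_less_mult)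
    then show ?thesis using s by (intro mult_add_less_mult) auto
  qed
  have "kron (swap_mat n) (1\<^sub>m s) * a * mat_adjoint (kron (swap_mat n) (1\<^sub>m s))
      = mat (n * s) (n * s) (\<lambda>(i, j). a $$ (?\<tau> i, ?\<tau> j))"
    unfolding X using a by (intro perm_mat_conj inv bound) (auto simp: ampl_def)
  moreover have "?\<tau> k div s \<noteq> ?\<tau> l div s" if "k div s \<noteq> l div s" for k l
    using that s by (auto simp: transpose_def)
  ultimately show ?thesis
    using a bound unfolding ampl_diag_iff[OF s] by (auto simp: kron_adjoint)
qed

lemma ampl_diag_kron:
  assumes "0 < s" "0 < m" "q \<in> carrier_mat m m" and a: "a \<in> ampl n (diag_alg n) s"
  shows "kron a q \<in> ampl n (diag_alg n) (s * m)"
proof -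
  have "k div m div s = k div (s * m)" for k by (metis div_mult2_eq mult.commute)
  moreover have "k div m < n * s" if "k < n * (s * m)" for k
    using that by (simp add: div_less_of_less_mult mult.assoc)
  ultimately show ?thesis
    using assms unfolding ampl_diag_iff[OF \<open>0 < s\<close>] ampl_diag_iff[OF mult_pos_pos[OF assms(1,2)]]
    by (auto simp: mult.assoc)
qed

lemma ampl_diag_add:
  assumes "0 < s" "a \<in> ampl n (diag_alg n) s" "b \<in> ampl n (diag_alg n) s"
  shows "a + b \<in> ampl n (diag_alg n) s"
  using assms unfolding ampl_diag_iff[OF assms(1)] by auto

text \<open>A controlled swap for one half of the digraph: a vector of the multiplicity space in the
  range of \<open>P\<close> leaves the vertices alone, one in the complement interchanges vertices 0
  and 1.\<close>

definition twist :: "nat \<Rightarrow> nat \<Rightarrow> complex mat \<Rightarrow> complex mat" where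
  "twist n s P = kron (1\<^sub>m (n * s)) P + kron (kron (swap_mat n) (1\<^sub>m s)) (compl P)"

lemma dim_twist [simp]:
  "dim_row (twist n s P) = n * s * dim_row P" "P \<in> carrier_mat m m \<Longrightarrow> dim_col (twist n s P) = n * s * m"
  by (auto simp: twist_def)

lemma twist_carrier [simp]: "P \<in> carrier_mat m m \<Longrightarrow> twist n s P \<in> carrier_mat (n * s * m) (n * s * m)"
  by (intro carrier_matI) auto

lemma twist_adjoint:
  assumes "projection m P"
  shows "mat_adjoint (twist n s P) = twist n s P"
  using assms compl_projection[OF assms]
  by (auto simp: projection_def twist_def mat_adjoint_add kron_adjoint)

lemma twist_conj:
  assumes "P \<in> carrier_mat m m" "Q \<in> carrier_mat m m" "a \<in> carrier_mat (n * s) (n * s)"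
  defines "X \<equiv> kron (swap_mat n) (1\<^sub>m s)"
  shows "twist n s P * kron a (1\<^sub>m m) * twist n s Q
    = kron a (P * Q) + kron (X * a) (compl P * Q)
      + (kron (a * X) (P * compl Q) + kron (X * a * X) (compl P * compl Q))"
  using assms
  by (auto simp: twist_def mult_add_dim add_mult_dim kron_mult one_mult_dim mult_one_dim mult_assoc_dim)

text \<open>The two mixed terms, with a single swap on one side of \<open>a\<close>, carry
  \<open>P * compl P\<close> or its reverse and vanish. Only terms that keep block diagonal matrices
  block diagonal survive.\<close>

lemma twist_conj_projection:
  assumes P: "projection m P" and a: "a \<in> carrier_mat (n * s) (n * s)"
  defines "X \<equiv> kron (swap_mat n) (1\<^sub>m s)"
  shows "twist n s P * kron a (1\<^sub>m m) * twist n s P = kron a P + kron (X * a * X) (compl P)"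
proof -
  have d: "P \<in> carrier_mat m m" "P * P = P" "compl P * compl P = compl P"
    using P compl_projection[OF P] by (auto simp: projection_def)
  have "dim_row (X * a * X) = n * s" "dim_col (X * a * X) = n * s" using a by (auto simp: X_def)
  then show ?thesis
    using a d twist_conj[OF d(1) d(1) a] mult_compl[OF P] compl_mult[OF P]
    by (auto simp: X_def)
qed

lemma twist_square:
  assumes "2 \<le> n" "projection m P"
  shows "twist n s P * twist n s P = 1\<^sub>m (n * s * m)"
proof -
  have P: "P \<in> carrier_mat m m" using assms(2) by (simp add: projection_def)
  then have "twist n s P * twist n s P = twist n s P * kron (1\<^sub>m (n * s)) (1\<^sub>m m) * twist n s P"
    by (simp add: mult_one_dim)
  also have "\<dots> = kron (1\<^sub>m (n * s)) (P + compl P)"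
    using P unfolding twist_conj_projection[OF assms(2) one_carrier_mat]
    by (auto simp: mult_one_dim kron_mult swap_mat_square[OF assms(1)] kron_add_right)
  finally show ?thesis using add_compl[OF P] by simp
qed

text \<open>
  In terms of symmetries, \<open>2 conv P Q - 1 = (2P - 1) \<otimes> (2Q - 1)\<close>.
\<close>

definition conv :: "complex mat \<Rightarrow> complex mat \<Rightarrow> complex mat" where
  "conv P Q = kron P Q + kron (compl P) (compl Q)"

lemma conv_carrier [simp]:
  "P \<in> carrier_mat m m \<Longrightarrow> Q \<in> carrier_mat l l \<Longrightarrow> conv P Q \<in> carrier_mat (m * l) (m * l)"
  by (auto simp: conv_def)

lemma projection_conv:
  assumes "projection m P" "projection l Q"
  shows "projection (m * l) (conv P Q)"
proof -
  have P: "P \<in> carrier_mat m m" "P * P = P" "mat_adjoint P = P"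
    "compl P * compl P = compl P" "mat_adjoint (compl P) = compl P"
    and Q: "Q \<in> carrier_mat l l" "Q * Q = Q" "mat_adjoint Q = Q"
    "compl Q * compl Q = compl Q" "mat_adjoint (compl Q) = compl Q"
    using assms assms[THEN compl_projection] by (auto simp: projection_def)
  have d: "dim_row P = m" "dim_col P = m" "dim_row Q = l" "dim_col Q = l" using P Q by auto
  have "conv P Q * conv P Q = conv P Q"
    using d P Q mult_compl[OF assms(1)] compl_mult[OF assms(1)]
    by (simp add: conv_def mult_add_dim add_mult_dim kron_mult zero_add_dim add_zero_dim)
  then show ?thesis
    using d P Q by (auto simp: projection_def conv_def mat_adjoint_add kron_adjoint)
qed

lemma compl_conv:
  assumes "P \<in> carrier_mat m m" "Q \<in> carrier_mat l l"
  shows "compl (conv P Q) = kron P (compl Q) + kron (compl P) Q"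
proof (rule compl_eqI)
  have "1\<^sub>m (m * l) = kron (P + compl P) (Q + compl Q)"
    using add_compl[OF assms(1)] add_compl[OF assms(2)] by simp
  also have "\<dots> = conv P Q + (kron P (compl Q) + kron (compl P) Q)"
    using assms unfolding conv_def
    by (subst kron_add_left; simp add: kron_add_right)
      (intro eq_matI; auto simp: algebra_simps)
  finally show "conv P Q + (kron P (compl Q) + kron (compl P) Q) = 1\<^sub>m (m * l)" ..
qed (use assms in auto)

text \<open>The swap is an involution, so two controlled swaps have an effect exactly where one
  control, but not the other, asks for it; that part of the multiplicity space is the complement of
  \<open>conv P Q\<close>.\<close>

lemma twist_twist:
  assumes n: "2 \<le> n" and P: "P \<in> carrier_mat m m" and Q: "Q \<in> carrier_mat l l"
  shows "twist n (s * m) Q * kron (twist n s P) (1\<^sub>m l) = twist n s (conv P Q)"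
proof -
  let ?X = "kron (swap_mat n) (1\<^sub>m s)"
  have d: "dim_row P = m" "dim_col P = m" "dim_row Q = l" "dim_col Q = l" using P Q by auto
  have "twist n (s * m) Q = kron (1\<^sub>m (n * s)) (kron (1\<^sub>m m) Q) + kron ?X (kron (1\<^sub>m m) (compl Q))"
    using d by (simp add: twist_def kron_assoc[symmetric] mult.assoc)
      (simp add: kron_assoc mult.assoc)
  moreover have "kron (twist n s P) (1\<^sub>m l)
      = kron (1\<^sub>m (n * s)) (kron P (1\<^sub>m l)) + kron ?X (kron (compl P) (1\<^sub>m l))"
    using d by (simp add: twist_def kron_add_left kron_assoc)
  ultimately have "twist n (s * m) Q * kron (twist n s P) (1\<^sub>m l)
      = kron (1\<^sub>m (n * s)) (kron P Q) + kron ?X (kron P (compl Q))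
        + (kron ?X (kron (compl P) Q) + kron (1\<^sub>m (n * s)) (kron (compl P) (compl Q)))"
    using d swap_mat_square[OF n]
    by (simp add: mult_add_dim add_mult_dim kron_mult one_mult_dim mult_one_dim)
  also have "\<dots> = kron (1\<^sub>m (n * s)) (conv P Q) + kron ?X (compl (conv P Q))"
    using d unfolding compl_conv[OF P Q] unfolding conv_def
    by (simp add: kron_add_right) (intro eq_matI; auto simp: algebra_simps)
  finally show ?thesis unfolding twist_def .
qed

section \<open>Separate controls for the upper and the lower half\<close>

definition twist2 :: "nat \<Rightarrow> nat \<Rightarrow> complex mat \<Rightarrow> complex mat \<Rightarrow> complex mat" where
  "twist2 n s P R = four_block_mat (twist n s P) (0\<^sub>m (n * s * dim_row P) (n * s * dim_row R))
     (0\<^sub>m (n * s * dim_row R) (n * s * dim_row P)) (twist n s R)"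

text \<open>With \<open>diag_proj\<close> and \<open>flat_proj\<close> for \<open>P\<close> and
  \<open>R\<close> this is the map \<theta> of the overview. For projections \<open>twist2\<close>
  is self-adjoint, so it stands on the right without an adjoint.\<close>

definition amp :: "nat \<Rightarrow> nat \<Rightarrow> complex mat \<Rightarrow> complex mat \<Rightarrow> complex mat \<Rightarrow> complex mat" where
  "amp n s P R x = twist2 n s P R * kron x (1\<^sub>m (dim_row P)) * twist2 n s P R"

lemma twist2_carrier [simp]:
  "P \<in> carrier_mat m m \<Longrightarrow> R \<in> carrier_mat m m \<Longrightarrow>
     twist2 n s P R \<in> carrier_mat (2 * n * s * m) (2 * n * s * m)"
  by (intro carrier_matI) (auto simp: twist2_def)

lemma dim_twist2 [simp]:
  "P \<in> carrier_mat m m \<Longrightarrow> R \<in> carrier_mat m m \<Longrightarrow> dim_row (twist2 n s P R) = 2 * n * s * m"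
  "P \<in> carrier_mat m m \<Longrightarrow> R \<in> carrier_mat m m \<Longrightarrow> dim_col (twist2 n s P R) = 2 * n * s * m"
  using twist2_carrier by (metis carrier_matD)+

lemma projectionD:
  assumes "projection m P"
  shows "P \<in> carrier_mat m m" "dim_row P = m" "dim_col P = m" "P * P = P" "mat_adjoint P = P"
  using assms by (auto simp: projection_def)

lemma twist2_adjoint:
  assumes "projection m P" "projection m R"
  shows "mat_adjoint (twist2 n s P R) = twist2 n s P R"
  using projectionD[OF assms(1)] projectionD[OF assms(2)]
  unfolding twist2_def
  by (subst mat_adjoint_four_block[of _ "n * s * m" "n * s * m" _ "n * s * m" _ "n * s * m"])
    (auto simp: twist_adjoint[OF assms(1)] twist_adjoint[OF assms(2)])

lemma mult_diag_four_block:
  fixes A B C D E F :: "complex mat"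
  assumes "A \<in> carrier_mat N N" "D \<in> carrier_mat N N" "E \<in> carrier_mat N N" "F \<in> carrier_mat N N"
    "B \<in> carrier_mat N N" "C \<in> carrier_mat N N"
  shows "four_block_mat A (0\<^sub>m N N) (0\<^sub>m N N) D * four_block_mat E B C F
      = four_block_mat (A * E) (A * B) (D * C) (D * F)"
    "four_block_mat E B C F * four_block_mat A (0\<^sub>m N N) (0\<^sub>m N N) D
      = four_block_mat (E * A) (B * D) (C * A) (F * D)"
  using assms
  by (auto simp: mult_four_block_mat[of _ N N _ N _ N _ _ N _ N] zero_add_dim add_zero_dim)

lemma twist2_square:
  assumes "2 \<le> n" "projection m P" "projection m R"
  shows "twist2 n s P R * twist2 n s P R = 1\<^sub>m (2 * n * s * m)"
proof -
  have "twist2 n s P R * twist2 n s P R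
      = four_block_mat (1\<^sub>m (n * s * m)) (0\<^sub>m (n * s * m) (n * s * m)) (0\<^sub>m (n * s * m) (n * s * m))
          (1\<^sub>m (n * s * m))"
    using projectionD[OF assms(2)] projectionD[OF assms(3)] assms
    by (simp add: twist2_def mult_diag_four_block twist_square)
  also have "\<dots> = 1\<^sub>m (2 * n * s * m)" by (simp add: mult_2[symmetric] mult.assoc)
  finally show ?thesis .
qed

lemma amp_carrier:
  assumes "projection m P" "projection m R" "x \<in> carrier_mat (2 * n * s) (2 * n * s)"
  shows "amp n s P R x \<in> carrier_mat (2 * n * s * m) (2 * n * s * m)"
  using projectionD[OF assms(1)] projectionD[OF assms(2)] assms(3)
  unfolding amp_def by (intro carrier_matI) auto

lemma star_hom_amp:
  assumes "2 \<le> n" "projection m P" "projection m R"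
  shows "star_hom (carrier_mat (2 * n * s) (2 * n * s))
    (carrier_mat (2 * n * s * m) (2 * n * s * m)) (amp n s P R)"
proof -
  have "star_hom (carrier_mat (2 * n * s) (2 * n * s)) (carrier_mat (2 * n * s * m) (2 * n * s * m))
      (\<lambda>x. twist2 n s P R * kron x (1\<^sub>m m) * mat_adjoint (twist2 n s P R))"
    using projectionD(1)[OF assms(2)] projectionD(1)[OF assms(3)]
    by (intro star_hom_comp[OF star_hom_kron star_hom_conj])
      (auto simp: twist2_adjoint[OF assms(2,3)] twist2_square[OF assms])
  then show ?thesis
    using projectionD(2)[OF assms(2)] unfolding amp_def[abs_def] twist2_adjoint[OF assms(2,3)] by simp
qed

lemma amp_one:
  assumes "2 \<le> n" "projection m P" "projection m R"
  shows "amp n s P R (1\<^sub>m (2 * n * s)) = 1\<^sub>m (2 * n * s * m)"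
  using projectionD[OF assms(2)] projectionD[OF assms(3)] twist2_square[OF assms]
  by (simp add: amp_def mult_one_dim)

text \<open>A diagonal corner sees one twist only, whereas an off-diagonal corner has the twist of
  \<open>P\<close> on one side and that of \<open>R\<close> on the other. Only there can a failure
  of \<open>P\<close> and \<open>R\<close> to commute become visible.\<close>

lemma amp_four_block:
  assumes P: "projection m P" and R: "projection m R"
    and abc: "a \<in> carrier_mat (n * s) (n * s)" "b \<in> carrier_mat (n * s) (n * s)"
    "c \<in> carrier_mat (n * s) (n * s)" "d \<in> carrier_mat (n * s) (n * s)"
  shows "amp n s P R (four_block_mat a b c d)
    = four_block_mat (twist n s P * kron a (1\<^sub>m m) * twist n s P)
        (twist n s P * kron b (1\<^sub>m m) * twist n s R)
        (twist n s R * kron c (1\<^sub>m m) * twist n s P)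
        (twist n s R * kron d (1\<^sub>m m) * twist n s R)"
proof -
  have "twist n s T * kron z (1\<^sub>m m) \<in> carrier_mat (n * s * m) (n * s * m)"
    if "T \<in> carrier_mat m m" "z \<in> carrier_mat (n * s) (n * s)" for T z
    using that by (intro carrier_matI) auto
  then show ?thesis
    using projectionD[OF P] projectionD[OF R] abc
    by (simp add: amp_def twist2_def kron_four_block[OF abc(1,2,3,4)]
        mult_diag_four_block[of _ "n * s * m"])
qed

lemma twist_conj_ampl_diag:
  assumes n: "2 \<le> n" and s: "0 < s" and m: "0 < m" and P: "projection m P"
    and a: "a \<in> ampl n (diag_alg n) s"
  shows "twist n s P * kron a (1\<^sub>m m) * twist n s P \<in> ampl n (diag_alg n) (s * m)"
proof -
  have ac: "a \<in> carrier_mat (n * s) (n * s)" using a by (auto simp: ampl_def)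
  show ?thesis
    unfolding twist_conj_projection[OF P ac]
    using projectionD(1)[OF P] projectionD(1)[OF compl_projection[OF P]] s m a
    by (intro ampl_diag_add ampl_diag_kron ampl_diag_swap[OF n]) auto
qed

lemma block_preserving_amp:
  assumes n: "2 \<le> n" and s: "0 < s" and m: "0 < m" and P: "projection m P" and R: "projection m R"
  shows "block_preserving n s (s * m) (amp n s P R)"
  unfolding block_preserving_def
proof (intro exI conjI ballI)
  let ?f = "\<lambda>P R a. twist n s P * kron a (1\<^sub>m m) * twist n s R"
  show "?f P P \<in> ampl n (diag_alg n) s \<rightarrow> ampl n (diag_alg n) (s * m)"
    "?f R R \<in> ampl n (diag_alg n) s \<rightarrow> ampl n (diag_alg n) (s * m)"
    using twist_conj_ampl_diag[OF n s m] P R by auto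
  show "?f P R \<in> carrier_mat (n * s) (n * s) \<rightarrow> carrier_mat (n * (s * m)) (n * (s * m))"
    using projectionD[OF P] projectionD[OF R] by (auto intro!: carrier_matI simp: mult.assoc)
  fix a b c :: "complex mat"
  assume "a \<in> ampl n (diag_alg n) s" "b \<in> carrier_mat (n * s) (n * s)" "c \<in> ampl n (diag_alg n) s"
  then have abc: "a \<in> carrier_mat (n * s) (n * s)" "b \<in> carrier_mat (n * s) (n * s)"
    "c \<in> carrier_mat (n * s) (n * s)" by (auto simp: ampl_def)
  show "amp n s P R (four_block_mat a b (0\<^sub>m (n * s) (n * s)) c)
      = four_block_mat (?f P P a) (?f P R b) (0\<^sub>m (n * (s * m)) (n * (s * m))) (?f R R c)"
    using projectionD[OF P] projectionD[OF R]
    by (simp add: amp_four_block[OF P R abc(1,2) zero_carrier_mat abc(3)] zero_mult_dim mult_zero_dim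
        mult.assoc)
qed

lemma block_preserving_AG:
  assumes "0 < r" "0 < s" "block_preserving n r s \<phi>"
  shows "\<phi> \<in> AG n r \<rightarrow> AG n s"
proof
  fix x assume "x \<in> AG n r"
  then obtain a b c where "a \<in> ampl n (diag_alg n) r" "b \<in> carrier_mat (n * r) (n * r)"
    "c \<in> ampl n (diag_alg n) r" "x = four_block_mat a b (0\<^sub>m (n * r) (n * r)) c"
    unfolding AG_four_block[OF assms(1)] by blast
  then show "\<phi> x \<in> AG n s"
    using assms(3) unfolding block_preserving_def AG_four_block[OF assms(2)] by blast
qed

text \<open>Composition amounts to multiplying the second conjugating unitary with the ampliation of
  the first one, which \<open>twist_twist\<close> evaluates in each half.\<close>

lemma amp_amp:
  assumes n: "2 \<le> n" and P: "projection m P" and R: "projection m R"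
    and Q: "projection l Q" and S: "projection l S" and x: "x \<in> carrier_mat (2 * n * s) (2 * n * s)"
  shows "amp n (s * m) Q S (amp n s P R x) = amp n s (conv P Q) (conv R S) x"
proof -
  note d = projectionD[OF P] projectionD[OF R] projectionD[OF Q] projectionD[OF S]
  let ?T = "twist2 n (s * m) Q S" and ?U = "twist2 n s P R" and ?N = "n * s * m * l"
  have "?T = four_block_mat (twist n (s * m) Q) (0\<^sub>m ?N ?N) (0\<^sub>m ?N ?N) (twist n (s * m) S)"
    using d by (simp add: twist2_def mult.assoc)
  moreover have "kron ?U (1\<^sub>m l) = four_block_mat (kron (twist n s P) (1\<^sub>m l)) (0\<^sub>m ?N ?N) (0\<^sub>m ?N ?N)
      (kron (twist n s R) (1\<^sub>m l))"
    using d unfolding twist2_def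
    by (subst kron_four_block[of _ "n * s * m" "n * s * m" _ "n * s * m" _ "n * s * m"]) auto
  moreover have "twist n (s * m) Q \<in> carrier_mat ?N ?N" "twist n (s * m) S \<in> carrier_mat ?N ?N"
    using d by (auto intro!: carrier_matI simp: mult.assoc)
  ultimately have "?T * kron ?U (1\<^sub>m l)
      = four_block_mat (twist n s (conv P Q)) (0\<^sub>m ?N ?N) (0\<^sub>m ?N ?N) (twist n s (conv R S))"
    using d by (simp add: mult_diag_four_block(1)[of _ ?N] zero_mult_dim mult_zero_dim
        twist_twist[OF n, of P m Q l s] twist_twist[OF n, of R m S l s]) (simp add: mult.assoc)
  also have "\<dots> = twist2 n s (conv P Q) (conv R S)"
    using projectionD[OF projection_conv[OF P Q]] projectionD[OF projection_conv[OF R S]]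
    by (simp add: twist2_def mult.assoc)
  finally have "?T * kron ?U (1\<^sub>m l) = twist2 n s (conv P Q) (conv R S)" .
  note 1 = this
  \<comment> \<open>The product in the opposite order is the adjoint of the one just computed, and a
    \<open>twist2\<close> of projections is self-adjoint.\<close>
  have "mat_adjoint (twist2 n (s * m) Q S * kron (twist2 n s P R) (1\<^sub>m l))
      = kron (twist2 n s P R) (1\<^sub>m l) * twist2 n (s * m) Q S"
    using d by (simp add: mat_adjoint_mult kron_adjoint twist2_adjoint[OF P R] twist2_adjoint[OF Q S]
        dim_twist2[of _ m] dim_twist2[of _ l])
  then have 2: "kron (twist2 n s P R) (1\<^sub>m l) * twist2 n (s * m) Q S = twist2 n s (conv P Q) (conv R S)"
    unfolding 1 by (simp add: twist2_adjoint[OF projection_conv[OF P Q] projection_conv[OF R S]])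
  have dims: "dim_row ?T = 2 * n * s * m * l" "dim_col ?T = 2 * n * s * m * l"
    "dim_row ?U = 2 * n * s * m" "dim_col ?U = 2 * n * s * m" "dim_row x = 2 * n * s" "dim_col x = 2 * n * s"
    using d x by (simp_all add: dim_twist2[of _ m] dim_twist2[of _ l] mult.assoc)
  have "kron (?U * kron x (1\<^sub>m m) * ?U) (1\<^sub>m l)
      = kron ?U (1\<^sub>m l) * kron x (1\<^sub>m (m * l)) * kron ?U (1\<^sub>m l)"
    using dims by (simp add: kron_mult one_mult_dim flip: kron_assoc kron_one)
  then have "amp n (s * m) Q S (amp n s P R x)
      = ?T * (kron ?U (1\<^sub>m l) * kron x (1\<^sub>m (m * l)) * kron ?U (1\<^sub>m l)) * ?T"
    using d by (simp add: amp_def)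
  also have "\<dots> = (?T * kron ?U (1\<^sub>m l)) * kron x (1\<^sub>m (m * l)) * (kron ?U (1\<^sub>m l) * ?T)"
    using dims by (simp add: mult_assoc_dim mult.assoc)
  also have "\<dots> = amp n s (conv P Q) (conv R S) x"
    using d unfolding 1 2 by (simp add: amp_def conv_def)
  finally show ?thesis .
qed

section \<open>The square of the basic map\<close>

definition swap_if :: "nat \<Rightarrow> bool \<Rightarrow> complex mat" where
  "swap_if n a = (if a then swap_mat n else 1\<^sub>m n)"

lemma dim_swap_if [simp]: "dim_row (swap_if n a) = n" "dim_col (swap_if n a) = n"
  by (simp_all add: swap_if_def)

lemma swap_if_carrier [simp]: "swap_if n a \<in> carrier_mat n n"
  by (simp add: swap_if_def)

lemma swap_if_adjoint [simp]: "mat_adjoint (swap_if n a) = swap_if n a"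
  by (simp add: swap_if_def)

definition swaps :: "nat \<Rightarrow> bool \<Rightarrow> bool \<Rightarrow> complex mat" where
  "swaps n a b = four_block_mat (swap_if n a) (0\<^sub>m n n) (0\<^sub>m n n) (swap_if n b)"

definition swaps_perm :: "nat \<Rightarrow> bool \<Rightarrow> bool \<Rightarrow> nat \<Rightarrow> nat" where
  "swaps_perm n a b i = (if a \<and> i < n then transpose 0 1 i
     else if b \<and> n \<le> i then n + transpose 0 1 (i - n) else i)"

lemma dim_swaps [simp]: "dim_row (swaps n a b) = 2 * n" "dim_col (swaps n a b) = 2 * n"
  by (simp_all add: swaps_def)

lemma swaps_carrier [simp]: "swaps n a b \<in> carrier_mat (2 * n) (2 * n)"
  by (intro carrier_matI) simp_all

definition swaps_conj :: "nat \<Rightarrow> nat \<Rightarrow> bool \<Rightarrow> bool \<Rightarrow> complex mat \<Rightarrow> complex mat \<Rightarrow> complex mat" where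
  "swaps_conj n s a b q x
    = kron (kron (swaps n a b) (1\<^sub>m s) * x * mat_adjoint (kron (swaps n a b) (1\<^sub>m s))) q"

text \<open>Rank one is expressed by a unitary that carries \<open>unit_mat m 0 0\<close> to
  \<open>q\<close>, the form in which \<open>has_multiplicity_kron\<close> accepts it.\<close>

definition rank_one_proj :: "nat \<Rightarrow> complex mat \<Rightarrow> bool" where
  "rank_one_proj m q \<longleftrightarrow> projection m q \<and>
     (\<exists>\<Omega>. unitary_mat m \<Omega> \<and> q = \<Omega> * unit_mat m 0 0 * mat_adjoint \<Omega>)"

context
  fixes n :: nat
  assumes n: "2 \<le> n"
begin

lemma swaps_perm_invol: "swaps_perm n a b (swaps_perm n a b i) = i"
  using n by (auto simp: swaps_perm_def transpose_def)

lemma swaps_perm_less: "i < n \<Longrightarrow> swaps_perm n a b i < n"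
  using n by (auto simp: swaps_perm_def transpose_def)

lemma swaps_perm_ge: "n \<le> i \<Longrightarrow> n \<le> swaps_perm n a b i"
  by (auto simp: swaps_perm_def)

lemma swaps_perm_less2: "swaps_perm n a b i < 2 * n" if "i < 2 * n"
proof (cases "i < n")
  case True
  then show ?thesis using swaps_perm_less[of i a b] by simp
next
  case False
  then show ?thesis using that n by (auto simp: swaps_perm_def transpose_def)
qed

text \<open>The bipartite digraph is complete, so every permutation that preserves the two halves is
  an automorphism.\<close>

lemma swaps_perm_automorphism: "G_automorphism n (swaps_perm n a b)"
proof -
  have fix': "swaps_perm n a b i = i" if "i \<ge> 2 * n" for i
    using that n by (auto simp: swaps_perm_def transpose_def)
  have "bij (swaps_perm n a b)"
    using swaps_perm_invol by (rule involuntory_imp_bij)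
  then have "swaps_perm n a b permutes {..<2 * n}"
    unfolding permutes_def using fix' by (auto simp: bij_iff)
  moreover have "swaps_perm n a b i = swaps_perm n a b j \<longleftrightarrow> i = j" for i j
    using swaps_perm_invol by metis
  moreover have "swaps_perm n a b i < n \<longleftrightarrow> i < n" for i
    using swaps_perm_less[of i a b] swaps_perm_ge[of i a b] by linarith
  moreover have "n \<le> swaps_perm n a b i \<longleftrightarrow> n \<le> i" for i
    using swaps_perm_less[of i a b] swaps_perm_ge[of i a b] by linarith
  ultimately show ?thesis
    unfolding G_automorphism_def G_edges_def by (auto simp: swaps_perm_less2)
qed

lemma swaps_eq_perm_mat: "swaps n a b = perm_mat (2 * n) (swaps_perm n a b)"
proof (rule eq_matI)
  fix i j assume "i < dim_row (perm_mat (2 * n) (swaps_perm n a b))"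
    "j < dim_col (perm_mat (2 * n) (swaps_perm n a b))"
  then have ij: "i < 2 * n" "j < 2 * n" by auto
  show "swaps n a b $$ (i, j) = perm_mat (2 * n) (swaps_perm n a b) $$ (i, j)"
    using ij n
    by (auto simp: swaps_def swap_if_def swap_mat_def perm_mat_def swaps_perm_def transpose_def)
qed auto

lemma unitary_swaps: "unitary_mat (2 * n) (swaps n a b)"
  unfolding swaps_eq_perm_mat
  by (rule unitary_perm_mat[of _ _ "swaps_perm n a b"])
    (auto simp: swaps_perm_less2 swaps_perm_invol)

lemma swaps_unit_mat:
  assumes "i < 2 * n" "j < 2 * n"
  shows "swaps n a b * unit_mat (2 * n) i j * mat_adjoint (swaps n a b)
    = unit_mat (2 * n) (swaps_perm n a b i) (swaps_perm n a b j)"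
proof -
  have eq: "k = swaps_perm n a b l \<longleftrightarrow> l = swaps_perm n a b k" for k l
    by (auto simp: swaps_perm_invol)
  have "swaps n a b * unit_mat (2 * n) i j * mat_adjoint (swaps n a b)
      = mat (2 * n) (2 * n) (\<lambda>(k, l). unit_mat (2 * n) i j $$ (swaps_perm n a b k, swaps_perm n a b l))"
    unfolding swaps_eq_perm_mat
    by (rule perm_mat_conj) (auto simp: swaps_perm_less2 swaps_perm_invol unit_mat_def)
  also have "\<dots> = unit_mat (2 * n) (swaps_perm n a b i) (swaps_perm n a b j)"
    by (intro eq_matI) (auto simp: unit_mat_def swaps_perm_less2 swaps_perm_invol)
  finally show ?thesis .
qed

lemma kron_swaps: "kron (swaps n a b) (1\<^sub>m s)
    = four_block_mat (kron (swap_if n a) (1\<^sub>m s)) (0\<^sub>m (n * s) (n * s)) (0\<^sub>m (n * s) (n * s))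
        (kron (swap_if n b) (1\<^sub>m s))"
  unfolding swaps_def by (subst kron_four_block[of _ n n _ n _ n]) auto

lemma unitary_kron_swaps: "unitary_mat (2 * n * s) (kron (swaps n a b) (1\<^sub>m s))"
  using unitary_swaps by (intro unitary_mat_kron) (auto simp: unitary_mat_def one_mult_dim)

lemma ampl_diag_swap_if:
  assumes "0 < s" "c \<in> ampl n (diag_alg n) s"
  shows "kron (swap_if n a) (1\<^sub>m s) * c * kron (swap_if n a) (1\<^sub>m s) \<in> ampl n (diag_alg n) s"
proof (cases a)
  case False
  have "c \<in> carrier_mat (n * s) (n * s)" using assms(2) by (auto simp: ampl_def)
  then show ?thesis using False assms(2) by (auto simp: swap_if_def one_mult_dim mult_one_dim)
qed (use ampl_diag_swap[OF n assms] in \<open>auto simp: swap_if_def\<close>)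

lemma block_preserving_swaps_conj:
  assumes s: "0 < s" and m: "0 < m" and q: "q \<in> carrier_mat m m"
  shows "block_preserving n s (s * m) (swaps_conj n s a b q)"
  unfolding block_preserving_def
proof (intro exI conjI ballI)
  let ?f = "\<lambda>a b x. kron (kron (swap_if n a) (1\<^sub>m s) * x * kron (swap_if n b) (1\<^sub>m s)) q"
  show "?f a a \<in> ampl n (diag_alg n) s \<rightarrow> ampl n (diag_alg n) (s * m)"
    "?f b b \<in> ampl n (diag_alg n) s \<rightarrow> ampl n (diag_alg n) (s * m)"
    using ampl_diag_kron[OF s m q] ampl_diag_swap_if[OF s] by auto
  show "?f a b \<in> carrier_mat (n * s) (n * s) \<rightarrow> carrier_mat (n * (s * m)) (n * (s * m))"
    using q by (auto intro!: carrier_matI simp: mult.assoc)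
  fix x y z :: "complex mat"
  assume "x \<in> ampl n (diag_alg n) s" "y \<in> carrier_mat (n * s) (n * s)" "z \<in> ampl n (diag_alg n) s"
  then have xyz: "x \<in> carrier_mat (n * s) (n * s)" "y \<in> carrier_mat (n * s) (n * s)"
    "z \<in> carrier_mat (n * s) (n * s)" by (auto simp: ampl_def)
  have c: "kron (swap_if n a) (1\<^sub>m s) * t \<in> carrier_mat (n * s) (n * s)"
    if "t \<in> carrier_mat (n * s) (n * s)" for a t
    using that by (intro carrier_matI) auto
  have k: "kron (swap_if n a) (1\<^sub>m s) \<in> carrier_mat (n * s) (n * s)" for a
    by (intro carrier_matI) auto
  have c': "t * kron (swap_if n a) (1\<^sub>m s) \<in> carrier_mat (n * s) (n * s)"
    if "t \<in> carrier_mat (n * s) (n * s)" for a t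
    using that by (intro carrier_matI) auto
  have "kron (swaps n a b) (1\<^sub>m s) * four_block_mat x y (0\<^sub>m (n * s) (n * s)) z
        * mat_adjoint (kron (swaps n a b) (1\<^sub>m s))
      = four_block_mat (kron (swap_if n a) (1\<^sub>m s) * x * kron (swap_if n a) (1\<^sub>m s))
          (kron (swap_if n a) (1\<^sub>m s) * y * kron (swap_if n b) (1\<^sub>m s)) (0\<^sub>m (n * s) (n * s))
          (kron (swap_if n b) (1\<^sub>m s) * z * kron (swap_if n b) (1\<^sub>m s))"
    unfolding kron_swaps
    using xyz c k
    by (simp add: mat_adjoint_four_block[of _ "n * s" "n * s" _ "n * s" _ "n * s"] kron_adjoint
        mult_diag_four_block[of _ "n * s"] zero_mult_dim mult_zero_dim del: assoc_mult_mat)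
  then show "swaps_conj n s a b q (four_block_mat x y (0\<^sub>m (n * s) (n * s)) z)
      = four_block_mat (?f a a x) (?f a b y) (0\<^sub>m (n * (s * m)) (n * (s * m))) (?f b b z)"
    unfolding swaps_conj_def using q
    by (simp add: kron_four_block[OF c'[OF c[OF xyz(1)]] c'[OF c[OF xyz(2)]] zero_carrier_mat
          c'[OF c[OF xyz(3)]]] mult.assoc del: assoc_mult_mat)
qed

lemma star_hom_swaps_conj:
  assumes "projection m q"
  shows "star_hom (carrier_mat (2 * n * s) (2 * n * s))
    (carrier_mat (2 * n * (s * m)) (2 * n * (s * m))) (swaps_conj n s a b q)"
  using star_hom_comp[OF star_hom_conj[of "kron (swaps n a b) (1\<^sub>m s)" "2 * n * s"]
      star_hom_kron[of q m "2 * n * s"]] assms unitary_kron_swaps[of s a b]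
  unfolding swaps_conj_def[abs_def] unitary_mat_def projection_def by (simp add: mult.assoc)

lemma multiplicity_one_swaps_conj:
  assumes s: "0 < s" and m: "0 < m" and q: "rank_one_proj m q"
  shows "multiplicity_one n s (s * m) (swaps_conj n s a b q)"
proof -
  obtain \<Omega> where \<Omega>: "projection m q" "unitary_mat m \<Omega>" "q = \<Omega> * unit_mat m 0 0 * mat_adjoint \<Omega>"
    using q by (auto simp: rank_one_proj_def)
  have AG: "swaps_conj n s a b q \<in> AG n s \<rightarrow> AG n (s * m)"
    using s m projectionD(1)[OF \<Omega>(1)]
    by (intro block_preserving_AG block_preserving_swaps_conj) auto
  have sub: "AG n s \<subseteq> carrier_mat (2 * n * s) (2 * n * s)" by (auto simp: AG_def ampl_def)
  have "has_multiplicity (2 * n * s) (2 * n * s * m) 1 (swaps_conj n s a b q)"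
    unfolding swaps_conj_def[abs_def] \<Omega>(3)
    by (rule has_multiplicity_kron[OF unitary_kron_swaps \<Omega>(2) m])
  then show ?thesis
    unfolding multiplicity_one_def
    using AG star_extension_of_star_hom[OF star_hom_swaps_conj[OF \<Omega>(1)] sub AG]
    by (auto simp: mult.assoc)
qed

text \<open>The swap acts on the vertex factor alone and merely renames matrix units. Hence the
  identity serves as the inner unitary and x \<mapsto> x \<otimes> q as the embedding of
  M_s.\<close>

lemma automorphism_type_swaps_conj:
  assumes s: "0 < s" and m: "0 < m" and q: "rank_one_proj m q"
  shows "automorphism_type n s (s * m) (swaps_conj n s a b q)"
proof -
  obtain \<Omega> where \<Omega>: "projection m q" "unitary_mat m \<Omega>" "q = \<Omega> * unit_mat m 0 0 * mat_adjoint \<Omega>"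
    using q by (auto simp: rank_one_proj_def)
  have one: "unitary_mat N (1\<^sub>m N)" for N by (simp add: unitary_mat_def one_mult_dim)
  have "has_multiplicity s (s * m) 1
      (\<lambda>x. kron (1\<^sub>m s * x * mat_adjoint (1\<^sub>m s)) (\<Omega> * unit_mat m 0 0 * mat_adjoint \<Omega>))"
    by (rule has_multiplicity_kron[OF one \<Omega>(2) m])
  then have mult: "has_multiplicity s (s * m) 1 (\<lambda>x. kron x q)"
    unfolding has_multiplicity_def \<Omega>(3) by (simp add: one_mult_dim mult_one_dim)
  have hom: "star_hom (carrier_mat s s) (carrier_mat (s * m) (s * m)) (\<lambda>x. kron x q)"
    using \<Omega>(1) by (intro star_hom_kron) (auto simp: projection_def)
  have AG1: "1\<^sub>m (2 * n * (s * m)) \<in> AG n (s * m)"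
    unfolding AG_iff[OF mult_pos_pos[OF s m]] G_edges_def
    by (auto simp: div_less_of_less_mult)
  have form: "swaps_conj n s a b q (kron (unit_mat (2 * n) i j) x)
      = 1\<^sub>m (2 * n * (s * m)) * kron (unit_mat (2 * n) (swaps_perm n a b i) (swaps_perm n a b j)) (kron x q)
        * mat_adjoint (1\<^sub>m (2 * n * (s * m)))"
    if ij: "i < 2 * n" "j < 2 * n" and x: "x \<in> carrier_mat s s" for i j x
  proof -
    have u: "dim_row (unit_mat N k l) = N" "dim_col (unit_mat N k l) = N" for N k l
      by (auto simp: unit_mat_def)
    have "swaps_conj n s a b q (kron (unit_mat (2 * n) i j) x)
        = kron (kron (unit_mat (2 * n) (swaps_perm n a b i) (swaps_perm n a b j)) x) q"
      using x u
      by (auto simp: swaps_conj_def kron_adjoint kron_mult one_mult_dim mult_one_dim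
          swaps_unit_mat[OF ij] simp del: assoc_mult_mat)
    then show ?thesis
      using x u projectionD[OF \<Omega>(1)]
      by (auto simp: kron_assoc one_mult_dim mult_one_dim mult.assoc)
  qed
  show ?thesis
    unfolding automorphism_type_def
    by (intro exI[of _ "swaps_perm n a b"] exI[of _ "\<lambda>x. kron x q"] exI[of _ "1\<^sub>m (2 * n * (s * m))"] conjI)
      (use form AG1 in \<open>auto simp: swaps_perm_automorphism hom mult[simplified] one G_edges_def\<close>)
qed

text \<open>On the range of \<open>q\<close> both controls are decided: the flags \<open>a\<close>
  and \<open>b\<close> say whether \<open>P\<close> and \<open>R\<close> annihilate it, that is,
  whether the upper and the lower pair are swapped. There \<open>twist2\<close> acts as a fixed
  permutation of the vertices.\<close>

lemma amp_summand:
  assumes P: "projection m P" and R: "projection m R" and q: "projection m q"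
    and Pq: "P * q = (if a then 0\<^sub>m m m else q)" and Rq: "R * q = (if b then 0\<^sub>m m m else q)"
    and x: "x \<in> carrier_mat (2 * n * s) (2 * n * s)"
  shows "twist2 n s P R * kron x q * twist2 n s P R = swaps_conj n s a b q x"
proof -
  note d = projectionD[OF P] projectionD[OF R] projectionD[OF q]
  have twist: "twist n s Q * kron (1\<^sub>m (n * s)) q = kron (kron (swap_if n c) (1\<^sub>m s)) q"
    if Q: "projection m Q" and Qq: "Q * q = (if c then 0\<^sub>m m m else q)" for Q c
  proof -
    have "compl Q * q = q - Q * q"
      using projectionD[OF Q] d minus_mult_distrib_mat[of "1\<^sub>m m" m m Q q m] by (simp add: one_mult_dim)
    also have "\<dots> = (if c then q else 0\<^sub>m m m)"
      using d unfolding Qq by (auto intro!: eq_matI)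
    finally have "compl Q * q = (if c then q else 0\<^sub>m m m)" .
    then show ?thesis
      using projectionD[OF Q] d Qq
      by (auto simp: twist_def add_mult_dim kron_mult one_mult_dim mult_one_dim swap_if_def
          zero_add_dim add_zero_dim)
  qed
  let ?N = "n * s * m" and ?S = "kron (swaps n a b) (1\<^sub>m s)" and ?T = "twist2 n s P R"
  have "kron (1\<^sub>m (2 * n * s)) q
      = kron (four_block_mat (1\<^sub>m (n * s)) (0\<^sub>m (n * s) (n * s)) (0\<^sub>m (n * s) (n * s)) (1\<^sub>m (n * s))) q"
    by (simp add: mult_2[symmetric] mult.assoc)
  also have "\<dots> = four_block_mat (kron (1\<^sub>m (n * s)) q) (0\<^sub>m ?N ?N) (0\<^sub>m ?N ?N) (kron (1\<^sub>m (n * s)) q)"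
    using d by (subst kron_four_block[of _ "n * s" "n * s" _ "n * s" _ "n * s"]) auto
  finally have "?T * kron (1\<^sub>m (2 * n * s)) q
      = four_block_mat (kron (kron (swap_if n a) (1\<^sub>m s)) q) (0\<^sub>m ?N ?N) (0\<^sub>m ?N ?N)
          (kron (kron (swap_if n b) (1\<^sub>m s)) q)"
    using d by (simp add: twist2_def mult_diag_four_block[of _ ?N] twist[OF P Pq] twist[OF R Rq]
        zero_mult_dim mult_zero_dim)
  also have "\<dots> = kron ?S q"
    unfolding kron_swaps using d
    by (subst kron_four_block[of _ "n * s" "n * s" _ "n * s" _ "n * s"]) (auto intro!: carrier_matI)
  finally have 1: "?T * kron (1\<^sub>m (2 * n * s)) q = kron ?S q" .
  have dT: "dim_row ?T = 2 * n * s * m" "dim_col ?T = 2 * n * s * m"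
    using d by (simp_all add: dim_twist2[of _ m])
  have "mat_adjoint (?T * kron (1\<^sub>m (2 * n * s)) q) = kron (1\<^sub>m (2 * n * s)) q * ?T"
    using d dT by (simp add: mat_adjoint_mult kron_adjoint twist2_adjoint[OF P R])
  then have 2: "kron (1\<^sub>m (2 * n * s)) q * ?T = kron (mat_adjoint ?S) q"
    unfolding 1 using d by (simp add: kron_adjoint)
  \<comment> \<open>Idempotence of \<open>q\<close> supplies one copy for each of the two
    conjugating factors.\<close>
  have "kron x q = kron (1\<^sub>m (2 * n * s)) q * kron x (1\<^sub>m m) * kron (1\<^sub>m (2 * n * s)) q"
    using d x by (auto simp: kron_mult one_mult_dim mult_one_dim)
  then have "?T * kron x q * ?T
      = (?T * kron (1\<^sub>m (2 * n * s)) q) * kron x (1\<^sub>m m) * (kron (1\<^sub>m (2 * n * s)) q * ?T)"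
    using d dT x by (auto simp: mult_assoc_dim)
  also have "\<dots> = swaps_conj n s a b q x"
    unfolding 1 2 using d x by (auto simp: kron_mult mult_one_dim swaps_conj_def)
  finally show ?thesis .
qed

end

text \<open>
  The common eigenvectors of \<open>p \<otimes> p\<close> and \<open>r \<otimes> r\<close>, up to the factor \<open>1 / \<surd>2\<close>.
\<close>

definition bell :: "nat \<Rightarrow> nat \<Rightarrow> complex" where
  "bell c g = [[1, 0, 0, 1], [1, 0, 0, -1], [0, 1, 1, 0], [0, 1, -1, 0]] ! c ! g"

definition bell_proj :: "nat \<Rightarrow> complex mat" where
  "bell_proj c = mat 4 4 (\<lambda>(g, h). bell c g * bell c h / 2)"

lemma less_4_cases: "(i::nat) < 4 \<Longrightarrow> i = 0 \<or> i = 1 \<or> i = 2 \<or> i = 3"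
  by auto

lemma eq_mat_4I:
  assumes "A \<in> carrier_mat 4 4" "B \<in> carrier_mat 4 4"
    "\<forall>i\<in>{0, 1, 2, 3}. \<forall>j\<in>{0, 1, 2, 3}. A $$ (i, j) = B $$ (i, j)"
  shows "A = B"
proof (rule eq_matI)
  fix i j assume "i < dim_row B" "j < dim_col B"
  then have "i < 4" "j < 4" using assms(2) by auto
  then show "A $$ (i, j) = B $$ (i, j)"
    using assms(3) less_4_cases[of i] less_4_cases[of j] by blast
qed (use assms in auto)

lemma sum_4: "(\<Sum>i = 0..<4::nat. f i) = f 0 + f 1 + f 2 + (f 3 :: complex)"
  by (simp add: eval_nat_numeral)

lemma cnj_bell: "c < 4 \<Longrightarrow> g < 4 \<Longrightarrow> cnj (bell c g) = bell c g"
  by (drule less_4_cases, drule less_4_cases) (auto simp: bell_def)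

lemma bell_orthogonal:
  "c < 4 \<Longrightarrow> d < 4 \<Longrightarrow> (\<Sum>g = 0..<4. bell c g * bell d g) = (if c = d then 2 else 0)"
  by (drule less_4_cases, drule less_4_cases) (auto simp: bell_def sum_4)

lemma bell_complete:
  "g < 4 \<Longrightarrow> h < 4 \<Longrightarrow> (\<Sum>c = 0..<4. bell c g * bell c h) = (if g = h then 2 else 0)"
  by (drule less_4_cases, drule less_4_cases) (auto simp: bell_def sum_4)

lemma dim_bell_proj [simp]: "dim_row (bell_proj c) = 4" "dim_col (bell_proj c) = 4"
  by (simp_all add: bell_proj_def)

lemma bell_proj_carrier [simp]: "bell_proj c \<in> carrier_mat 4 4"
  by (simp add: bell_proj_def)

lemma bell_proj_mult:
  assumes "c < 4" "d < 4"
  shows "bell_proj c * bell_proj d = (if c = d then bell_proj c else 0\<^sub>m 4 4)"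
proof (rule eq_matI)
  fix g h
  let ?E = "if c = d then bell_proj c else 0\<^sub>m 4 4"
  assume "g < dim_row ?E" "h < dim_col ?E"
  then have gh: "g < 4" "h < 4" by (auto split: if_splits)
  have "(bell_proj c * bell_proj d) $$ (g, h)
      = (\<Sum>t = 0..<4. bell c g * bell c t / 2 * (bell d t * bell d h / 2))"
    using gh by (simp add: bell_proj_def scalar_prod_def)
  also have "\<dots> = bell c g * bell d h / 4 * (\<Sum>t = 0..<4. bell c t * bell d t)"
    by (simp add: sum_4 field_simps)
  also have "\<dots> = ?E $$ (g, h)"
    unfolding bell_orthogonal[OF assms] using gh by (auto simp: bell_proj_def)
  finally show "(bell_proj c * bell_proj d) $$ (g, h) = ?E $$ (g, h)" .
qed auto

lemma rank_one_bell_proj: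
  assumes c: "c < 4"
  shows "rank_one_proj 4 (bell_proj c)"
proof -
  define r where "r = complex_of_real (sqrt (1 / 2))"
  have r: "r * r = 1 / 2" "cnj r = r"
    by (simp_all add: r_def flip: of_real_mult)
  \<comment> \<open>The columns are the normalised \<open>bell\<close> vectors, cyclically shifted
    so that vector \<open>c\<close> becomes column 0, the one selected by
    \<open>unit_mat 4 0 0\<close>.\<close>
  define \<Omega> where "\<Omega> = mat 4 4 (\<lambda>(g, h). r * bell ((h + c) mod 4) g)"
  have \<Omega>c: "\<Omega> \<in> carrier_mat 4 4" by (simp add: \<Omega>_def)
  have r4: "r * x * (r * y) = x * y / 2" for x y
    using r(1) by (simp add: mult_ac)
  have perm: "(\<Sum>t = 0..<4. f ((t + c) mod 4)) = (\<Sum>t = 0..<4. f t)" for f :: "nat \<Rightarrow> complex"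
    using less_4_cases[OF c] by (auto simp: sum_4 simp flip: numeral_2_eq_2)
  have u: "\<Omega> * mat_adjoint \<Omega> = 1\<^sub>m 4"
  proof (rule eq_matI)
    fix g h assume "g < dim_row (1\<^sub>m 4 :: complex mat)" "h < dim_col (1\<^sub>m 4 :: complex mat)"
    then have gh: "g < 4" "h < 4" by auto
    have "(\<Omega> * mat_adjoint \<Omega>) $$ (g, h)
        = (\<Sum>t = 0..<4. bell ((t + c) mod 4) g * bell ((t + c) mod 4) h / 2)"
      using gh by (simp add: \<Omega>_def scalar_prod_def cnj_bell r r4)
    also have "\<dots> = 1\<^sub>m 4 $$ (g, h)"
      using gh perm[of "\<lambda>t. bell t g * bell t h / 2"] bell_complete[OF gh]
      by (simp add: sum_divide_distrib[symmetric])
    finally show "(\<Omega> * mat_adjoint \<Omega>) $$ (g, h) = 1\<^sub>m 4 $$ (g, h)" .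
  qed (use \<Omega>c in auto)
  have "\<Omega> * unit_mat 4 0 0 = mat 4 4 (\<lambda>(g, h). if h = 0 then r * bell c g else 0)"
    using c by (intro eq_matI) (auto simp: \<Omega>_def unit_mat_def scalar_prod_def sum_4)
  then have q: "bell_proj c = \<Omega> * unit_mat 4 0 0 * mat_adjoint \<Omega>"
    using c by (intro eq_matI) (auto simp: \<Omega>_def bell_proj_def scalar_prod_def sum_4 cnj_bell r r4)
  have "mat_adjoint (bell_proj c) = bell_proj c"
    using c by (intro eq_matI) (auto simp: bell_proj_def cnj_bell)
  then show ?thesis
    unfolding rank_one_proj_def projection_def
    using unitary_matI[OF \<Omega>c u] q bell_proj_mult[OF c c] bell_proj_carrier[of c] by auto
qed

section \<open>The anticommuting pair and its tensor square\<close>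

definition diag_proj :: "complex mat" where
  "diag_proj = mat 2 2 (\<lambda>(i, j). if i = 0 \<and> j = 0 then 1 else 0)"

text \<open>The projection onto the line of (1, 1). The symmetries of \<open>diag_proj\<close> and
  \<open>flat_proj\<close> are diag(1, -1) and the interchange of the two coordinates, i.e. the
  Pauli matrices Z and X.\<close>

definition flat_proj :: "complex mat" where
  "flat_proj = mat 2 2 (\<lambda>_. 1 / 2)"

lemma projection_diag_proj: "projection 2 diag_proj"
  unfolding projection_def
proof (intro conjI)
  show "diag_proj * diag_proj = diag_proj" "mat_adjoint diag_proj = diag_proj"
    by (intro eq_matI; simp add: diag_proj_def scalar_prod_def numeral_2_eq_2)+
qed (simp add: diag_proj_def)

lemma projection_flat_proj: "projection 2 flat_proj"
  unfolding projection_def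
proof (intro conjI)
  show "flat_proj * flat_proj = flat_proj" "mat_adjoint flat_proj = flat_proj"
    by (intro eq_matI; simp add: flat_proj_def scalar_prod_def)+
qed (simp add: flat_proj_def)

text \<open>Z \<otimes> Z is 1 on the basis vectors 0 and 3 and -1 on 1 and 2; the former carry the
  \<open>bell\<close> vectors with c < 2, the latter the other two.\<close>

lemma conv_diag_proj:
  assumes "c < 4"
  shows "conv diag_proj diag_proj * bell_proj c = (if 2 \<le> c then 0\<^sub>m 4 4 else bell_proj c)"
proof -
  have P: "conv diag_proj diag_proj = mat 4 4 (\<lambda>(i, j). if i = j \<and> (i = 0 \<or> i = 3) then 1 else 0)"
    by (intro eq_mat_4I) (auto simp: conv_def diag_proj_def intro!: carrier_matI)
  show ?thesis
    unfolding P using less_4_cases[OF assms]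
    by (intro eq_mat_4I)
      (auto simp: bell_proj_def bell_def scalar_prod_def sum_4)
qed

text \<open>X \<otimes> X sends index i to 3 - i, and \<open>bell c\<close> is symmetric under this
  for even c, antisymmetric for odd c. Thus the high bit of c tells whether the upper pair is
  swapped and the low bit whether the lower one is.\<close>

lemma conv_flat_proj:
  assumes "c < 4"
  shows "conv flat_proj flat_proj * bell_proj c = (if odd c then 0\<^sub>m 4 4 else bell_proj c)"
proof -
  have P: "conv flat_proj flat_proj = mat 4 4 (\<lambda>(i, j). if i = j \<or> i + j = 3 then 1 / 2 else 0)"
    by (intro eq_mat_4I) (auto simp: conv_def flat_proj_def intro!: carrier_matI)
  show ?thesis
    unfolding P using less_4_cases[OF assms]
    by (intro eq_mat_4I)
      (auto simp: bell_proj_def bell_def scalar_prod_def sum_4)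
qed

lemma bell_proj_sum: "bell_proj 0 + (bell_proj 1 + (bell_proj 2 + bell_proj 3)) = 1\<^sub>m 4"
  by (intro eq_mat_4I) (auto simp: bell_proj_def bell_def)

definition double_amp :: "nat \<Rightarrow> nat \<Rightarrow> complex mat \<Rightarrow> complex mat" where
  "double_amp n s = amp n s (conv diag_proj diag_proj) (conv flat_proj flat_proj)"

text \<open>Splitting the identity of the multiplicity space into the four \<open>bell_proj\<close>
  splits the map into orthogonal summands, one for each choice of swapping or not swapping in the
  two halves.\<close>

lemma family_G_double_amp:
  assumes n: "2 \<le> n" and s: "0 < s"
  shows "family_G n (AG n s) (AG n (s * 4)) (double_amp n s)"
proof -
  let ?P = "conv diag_proj diag_proj" and ?R = "conv flat_proj flat_proj"
  have P: "projection 4 ?P" and R: "projection 4 ?R"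
    using projection_conv[OF projection_diag_proj projection_diag_proj]
      projection_conv[OF projection_flat_proj projection_flat_proj] by simp_all
  define \<psi> where "\<psi> c = swaps_conj n s (2 \<le> c) (odd c) (bell_proj c)" for c :: nat
  define \<psi>s where "\<psi>s = map \<psi> [0, 1, 2, 3]"
  have bell: "rank_one_proj 4 (bell_proj c)" "projection 4 (bell_proj c)" if "c < 4" for c
    using rank_one_bell_proj[OF that] by (auto simp: rank_one_proj_def)
  have sub: "AG n s \<subseteq> carrier_mat (2 * n * s) (2 * n * s)" by (auto simp: AG_def ampl_def)
  have dT: "dim_row (twist2 n s ?P ?R) = 2 * n * s * 4" "dim_col (twist2 n s ?P ?R) = 2 * n * s * 4"
    using projectionD(1)[OF P] projectionD(1)[OF R] by (simp_all only: dim_twist2)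
  have orth: "\<psi> c x * \<psi> d y = 0\<^sub>m (2 * n * (s * 4)) (2 * n * (s * 4))"
    if "c < 4" "d < 4" "c \<noteq> d" "x \<in> AG n s" "y \<in> AG n s" for c d x y
  proof -
    have "x \<in> carrier_mat (2 * n * s) (2 * n * s)" "y \<in> carrier_mat (2 * n * s) (2 * n * s)"
      using that sub by auto
    then show ?thesis
      by (simp add: \<psi>_def swaps_conj_def kron_mult bell_proj_mult[OF that(1,2)] that(3) mult.assoc)
  qed
  have summand: "twist2 n s ?P ?R * kron x (bell_proj c) * twist2 n s ?P ?R = \<psi> c x"
    if "c < 4" "x \<in> carrier_mat (2 * n * s) (2 * n * s)" for c x
    unfolding \<psi>_def
    by (rule amp_summand[OF n P R bell(2)[OF that(1)] _ _ that(2)])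
      (use conv_diag_proj[OF that(1)] conv_flat_proj[OF that(1)] in simp_all)
  have sum: "double_amp n s x = foldr (+) (map (\<lambda>\<psi>. \<psi> x) \<psi>s) (0\<^sub>m (2 * n * (s * 4)) (2 * n * (s * 4)))"
    if "x \<in> AG n s" for x
  proof -
    have x: "x \<in> carrier_mat (2 * n * s) (2 * n * s)" using that sub by auto
    have d\<psi>: "dim_row (\<psi> c x) = 2 * n * s * 4" "dim_col (\<psi> c x) = 2 * n * s * 4" for c
      by (simp_all add: \<psi>_def swaps_conj_def)
    have "double_amp n s x = twist2 n s ?P ?R
        * kron x (bell_proj 0 + (bell_proj 1 + (bell_proj 2 + bell_proj 3))) * twist2 n s ?P ?R"
      unfolding double_amp_def amp_def bell_proj_sum projectionD(2)[OF P] ..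
    also have "\<dots> = \<psi> 0 x + (\<psi> 1 x + (\<psi> 2 x + \<psi> 3 x))"
      using x dT
      by (simp add: kron_add_right mult_add_dim add_mult_dim del: assoc_mult_mat)
        (simp add: summand[OF _ x, simplified] del: assoc_mult_mat)
    also have "\<dots> = foldr (+) (map (\<lambda>\<psi>. \<psi> x) \<psi>s) (0\<^sub>m (2 * n * (s * 4)) (2 * n * (s * 4)))"
      by (simp add: \<psi>s_def add_zero_dim d\<psi> mult.assoc)
    finally show ?thesis .
  qed
  have nth: "\<psi>s ! i = \<psi> i" if "i < 4" for i
    using less_4_cases[OF that] by (auto simp: \<psi>s_def)
  have len: "length \<psi>s = 4" by (simp add: \<psi>s_def)
  have direct: "direct_sum_of n s (s * 4) (double_amp n s) \<psi>s"
    unfolding direct_sum_of_def len using orth sum by (simp add: nth)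
  have mult: "multiplicity_one n s (s * 4) \<phi>" "automorphism_type n s (s * 4) \<phi>" if "\<phi> \<in> set \<psi>s" for \<phi>
    using that s multiplicity_one_swaps_conj[OF n s _ bell(1)] automorphism_type_swaps_conj[OF n s _ bell(1)]
    by (auto simp: \<psi>s_def \<psi>_def)
  have block: "block_preserving n s (s * 4) (double_amp n s)"
    unfolding double_amp_def by (rule block_preserving_amp[OF n s _ P R]) simp
  have AG: "double_amp n s \<in> AG n s \<rightarrow> AG n (s * 4)"
    using block_preserving_AG[OF s _ block] s by simp
  have "star_extension (AG n s) (AG n (s * 4)) (double_amp n s) (double_amp n s)"
    using star_hom_amp[OF n P R] unfolding double_amp_def[symmetric]
    by (rule star_extension_of_star_hom[OF _ sub AG])
  then have "regular n s (s * 4) (double_amp n s)"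
    unfolding regular_def star_extendible_def using AG direct mult(1) by blast
  moreover have "double_amp n s (1\<^sub>m (2 * n * s)) = 1\<^sub>m (2 * n * (s * 4))"
    using amp_one[OF n P R] by (simp add: double_amp_def mult.assoc)
  ultimately have "family_F n (AG n s) (AG n (s * 4)) (double_amp n s)"
    unfolding family_F_def using s block by (intro exI[of _ s] exI[of _ "s * 4"]) auto
  moreover have "\<exists>\<psi>s. direct_sum_of n s (s * 4) (double_amp n s) \<psi>s \<and>
      (\<forall>\<psi>\<in>set \<psi>s. multiplicity_one n s (s * 4) \<psi> \<and> automorphism_type n s (s * 4) \<psi>)"
    using direct mult by blast
  ultimately show ?thesis
    unfolding family_G_def using s by (intro conjI exI[of _ s] exI[of _ "s * 4"]) auto
qed

section \<open>A sign obstruction to regularity\<close>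

text \<open>Real entries make these matrices self-adjoint and their squares entrywise nonnegative;
  the latter is what finally contradicts the eigenvalue -1.\<close>

definition real_diag :: "nat \<Rightarrow> (nat \<Rightarrow> real) \<Rightarrow> complex mat" where
  "real_diag N f = mat N N (\<lambda>(i, j). if i = j then complex_of_real (f i) else 0)"

lemma dim_real_diag [simp]: "dim_row (real_diag N f) = N" "dim_col (real_diag N f) = N"
  by (simp_all add: real_diag_def)

lemma real_diag_carrier [simp]: "real_diag N f \<in> carrier_mat N N"
  by (simp add: real_diag_def)

lemma real_diag_adjoint [simp]: "mat_adjoint (real_diag N f) = real_diag N f"
  by (intro eq_matI) (auto simp: real_diag_def)

lemma real_diag_mult_left:
  assumes "A \<in> carrier_mat N M"
  shows "real_diag N f * A = mat N M (\<lambda>(i, j). complex_of_real (f i) * A $$ (i, j))"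
  using assms
  by (intro eq_matI) (auto simp: real_diag_def scalar_prod_def if_distrib[of "\<lambda>c. c * _"] cong: if_cong)

lemma mult_real_diag_right:
  assumes "A \<in> carrier_mat M N"
  shows "A * real_diag N f = mat M N (\<lambda>(i, j). A $$ (i, j) * complex_of_real (f j))"
  using assms
  by (intro eq_matI) (auto simp: real_diag_def scalar_prod_def if_distrib[of "\<lambda>c. _ * c"] cong: if_cong)

lemma real_diag_mult: "real_diag N f * real_diag N g = real_diag N (\<lambda>i. f i * g i)"
  by (subst real_diag_mult_left[where M = N]) (auto intro!: eq_matI simp: real_diag_def)

lemma kron_real_diag_one: "kron (real_diag N f) (1\<^sub>m s) = real_diag (N * s) (\<lambda>k. f (k div s))"
proof (rule eq_matI)
  fix k l assume "k < dim_row (real_diag (N * s) (\<lambda>k. f (k div s)))"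
    "l < dim_col (real_diag (N * s) (\<lambda>k. f (k div s)))"
  then have kl: "k < N * s" "l < N * s" by auto
  have "k div s = l div s \<Longrightarrow> k mod s \<noteq> l mod s" if "k \<noteq> l"
    using that by (metis div_mult_mod_eq)
  then show "kron (real_diag N f) (1\<^sub>m s) $$ (k, l) = real_diag (N * s) (\<lambda>k. f (k div s)) $$ (k, l)"
    using kl div_less_of_less_mult[OF kl(1)] div_less_of_less_mult[OF kl(2)]
      mod_less_of_less_mult[OF kl(1)] mod_less_of_less_mult[OF kl(2)]
    by (cases "k = l") (auto simp: real_diag_def)
qed auto

text \<open>The diagonal of e_0 - e_1, an element that the swap of vertices 0 and 1 turns into its
  negative. The value 0 makes the vertices outside the pair invisible.\<close>

definition pair_sign :: "nat \<Rightarrow> real" where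
  "pair_sign i = (if i = 0 then 1 else if i = 1 then -1 else 0)"

definition upper_sign :: "nat \<Rightarrow> nat \<Rightarrow> complex mat" where
  "upper_sign n s = kron (real_diag (2 * n) (\<lambda>i. if i < n then pair_sign i else 0)) (1\<^sub>m s)"

definition lower_sign :: "nat \<Rightarrow> nat \<Rightarrow> complex mat" where
  "lower_sign n s = kron (real_diag (2 * n) (\<lambda>i. if n \<le> i then pair_sign (i - n) else 0)) (1\<^sub>m s)"

lemma dim_signs [simp]:
  "dim_row (upper_sign n s) = 2 * n * s" "dim_col (upper_sign n s) = 2 * n * s"
  "dim_row (lower_sign n s) = 2 * n * s" "dim_col (lower_sign n s) = 2 * n * s"
  by (simp_all add: upper_sign_def lower_sign_def)

lemma signs_carrier [simp]:
  "upper_sign n s \<in> carrier_mat (2 * n * s) (2 * n * s)"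
  "lower_sign n s \<in> carrier_mat (2 * n * s) (2 * n * s)"
  by (auto intro: carrier_matI)

lemma signs_mult:
  "upper_sign n (s * m) = kron (upper_sign n s) (1\<^sub>m m)"
  "lower_sign n (s * m) = kron (lower_sign n s) (1\<^sub>m m)"
  by (simp_all add: upper_sign_def lower_sign_def kron_assoc)

lemma upper_sign_four_block:
  "upper_sign n s = four_block_mat (kron (real_diag n pair_sign) (1\<^sub>m s))
     (0\<^sub>m (n * s) (n * s)) (0\<^sub>m (n * s) (n * s)) (0\<^sub>m (n * s) (n * s))"
proof -
  have "real_diag (2 * n) (\<lambda>i. if i < n then pair_sign i else 0)
      = four_block_mat (real_diag n pair_sign) (0\<^sub>m n n) (0\<^sub>m n n) (0\<^sub>m n n)"
    by (intro eq_matI) (auto simp: real_diag_def)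
  then show ?thesis
    unfolding upper_sign_def by (simp add: kron_four_block[of _ n n _ n _ n])
qed

lemma lower_sign_four_block:
  "lower_sign n s = four_block_mat (0\<^sub>m (n * s) (n * s)) (0\<^sub>m (n * s) (n * s))
     (0\<^sub>m (n * s) (n * s)) (kron (real_diag n pair_sign) (1\<^sub>m s))"
proof -
  have "real_diag (2 * n) (\<lambda>i. if n \<le> i then pair_sign (i - n) else 0)
      = four_block_mat (0\<^sub>m n n) (0\<^sub>m n n) (0\<^sub>m n n) (real_diag n pair_sign)"
    by (intro eq_matI) (auto simp: real_diag_def)
  then show ?thesis
    unfolding lower_sign_def by (simp add: kron_four_block[of _ n n _ n _ n])
qed

lemma swap_pair_sign:
  assumes "2 \<le> n"
  shows "swap_mat n * real_diag n pair_sign * swap_mat n = (-1) \<cdot>\<^sub>m real_diag n pair_sign"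
proof -
  have "swap_mat n * real_diag n pair_sign * mat_adjoint (swap_mat n)
      = mat n n (\<lambda>(i, j). real_diag n pair_sign $$ (transpose 0 1 i, transpose 0 1 j))"
    unfolding swap_mat_def using assms
    by (intro perm_mat_conj transpose_eq_flip transpose_less) auto
  also have "\<dots> = (-1) \<cdot>\<^sub>m real_diag n pair_sign"
    using assms
    by (intro eq_matI) (auto simp: real_diag_def pair_sign_def transpose_def)
  finally show ?thesis by simp
qed

text \<open>Write a for the sign element. The swap negates it, so a \<otimes> P + (-a) \<otimes> (1
  - P) collapses to a \<otimes> (2P - 1): conjugation exposes the symmetry of \<open>P\<close> in
  the multiplicity space.\<close>

lemma twist_pair_sign:
  assumes n: "2 \<le> n" and P: "projection m P"
  shows "twist n s P * kron (kron (real_diag n pair_sign) (1\<^sub>m s)) (1\<^sub>m m) * twist n s P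
    = kron (kron (real_diag n pair_sign) (1\<^sub>m s)) (P - compl P)"
proof -
  note d = projectionD[OF P]
  have "kron (swap_mat n) (1\<^sub>m s) * kron (real_diag n pair_sign) (1\<^sub>m s) * kron (swap_mat n) (1\<^sub>m s)
      = (-1) \<cdot>\<^sub>m kron (real_diag n pair_sign) (1\<^sub>m s)"
    by (simp add: kron_mult one_mult_dim swap_pair_sign[OF n] kron_smult_left del: assoc_mult_mat)
  then show ?thesis
    using d by (subst twist_conj_projection[OF P], (auto)[1])
      (intro eq_matI; auto simp: kron_smult_left mod_less_of_less_mult algebra_simps)
qed

lemma amp_signs:
  assumes n: "2 \<le> n" and P: "projection m P" and R: "projection m R"
  shows "amp n s P R (upper_sign n s) = kron (upper_sign n s) (P - compl P)"
    "amp n s P R (lower_sign n s) = kron (lower_sign n s) (R - compl R)"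
proof -
  note d = projectionD[OF P] projectionD[OF R]
  have z: "twist n s A * 0\<^sub>m (n * s * m) (n * s * m) * twist n s B = 0\<^sub>m (n * s * m) (n * s * m)"
    if "A \<in> carrier_mat m m" "B \<in> carrier_mat m m" for A B
    using that by (simp add: mult_zero_dim zero_mult_dim)
  show "amp n s P R (upper_sign n s) = kron (upper_sign n s) (P - compl P)"
    unfolding upper_sign_four_block
    using d by (simp add: amp_four_block[OF P R] z twist_pair_sign[OF n P]
        kron_four_block[of _ "n * s" "n * s" _ "n * s" _ "n * s"] del: assoc_mult_mat)
  show "amp n s P R (lower_sign n s) = kron (lower_sign n s) (R - compl R)"
    unfolding lower_sign_four_block
    using d by (simp add: amp_four_block[OF P R] z twist_pair_sign[OF n R]
        kron_four_block[of _ "n * s" "n * s" _ "n * s" _ "n * s"] del: assoc_mult_mat)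
qed

text \<open>
  If \<open>y\<close> is the image of a matrix unit, then \<open>upper_sign * y * lower_sign\<close> represents the product of
  the symmetries \<open>p\<close> and \<open>r\<close>, and this word detects the square of that product: it is \<open>- y\<close> when they
  anticommute, but never for a regular map.
\<close>

definition sign_word :: "nat \<Rightarrow> nat \<Rightarrow> complex mat \<Rightarrow> complex mat" where
  "sign_word n s y = (upper_sign n s * y * lower_sign n s) * mat_adjoint y
     * (upper_sign n s * y * lower_sign n s)"

text \<open>After moving the twists outwards, each of the two outer factors of the word contributes
  \<open>z\<close> to the multiplicity space and the middle adjoint contributes 1. The total is
  \<open>z * z\<close>, a scalar that comes out as -1.\<close>

lemma sign_word_amp:
  assumes n: "2 \<le> n" and P: "projection m P" and R: "projection m R"
    and y: "y \<in> carrier_mat (2 * n * s) (2 * n * s)"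
  defines "z \<equiv> (P - compl P) * (R - compl R)"
  assumes z: "z * z = (-1) \<cdot>\<^sub>m 1\<^sub>m m"
  shows "sign_word n (s * m) (amp n s P R y) = (-1) \<cdot>\<^sub>m amp n s P R (sign_word n s y)"
proof -
  note d = projectionD[OF P] projectionD[OF R]
  let ?T = "twist2 n s P R" and ?J = "upper_sign n s" and ?L = "lower_sign n s"
  let ?p = "P - compl P" and ?r = "R - compl R" and ?N = "2 * n * s * m"
  have dT: "dim_row ?T = ?N" "dim_col ?T = ?N"
    using d by (simp_all add: dim_twist2[of _ m])
  have yd: "dim_row y = 2 * n * s" "dim_col y = 2 * n * s" using y by auto
  have T2: "?T * ?T = 1\<^sub>m ?N" by (rule twist2_square[OF n P R])
  have TT: "?T * (?T * A) = A" if "dim_row A = ?N" for A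
    using that dT mult_assoc_dim[of ?T ?T A] by (simp add: T2 one_mult_dim)
  have zd: "dim_row z = m" "dim_col z = m" using d by (auto simp: z_def)
  have conj: "amp n s P R x = ?T * (kron x (1\<^sub>m m) * ?T)" if "dim_row x = 2 * n * s" "dim_col x = 2 * n * s" for x
    using that d dT by (simp add: amp_def mult_assoc_dim)
  \<comment> \<open>This is \<open>amp_signs\<close> with one \<open>twist2\<close> cancelled:
    passing the sign through the unitary replaces the identity of the multiplicity space by the
    symmetry of \<open>P\<close>.\<close>
  have J: "kron ?J (1\<^sub>m m) * ?T = ?T * kron ?J ?p"
  proof -
    have "?T * (?T * (kron ?J (1\<^sub>m m) * ?T)) = ?T * kron ?J ?p"
      using amp_signs(1)[OF n P R, of s] d by (simp add: conj)
    then show ?thesis using d dT by (simp add: TT)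
  qed
  have L: "?T * kron ?L (1\<^sub>m m) = kron ?L ?r * ?T"
  proof -
    have "?T * (kron ?L (1\<^sub>m m) * ?T) = kron ?L ?r"
      using amp_signs(2)[OF n P R, of s] d by (simp add: conj)
    then have "?T * (kron ?L (1\<^sub>m m) * ?T) * ?T = kron ?L ?r * ?T" by simp
    then show ?thesis using d dT by (simp add: mult_assoc_dim T2 mult_one_dim)
  qed
  let ?A = "?J * y * ?L"
  have Ad: "dim_row ?A = 2 * n * s" "dim_col ?A = 2 * n * s" using yd by auto
  have 1: "upper_sign n (s * m) * amp n s P R y * lower_sign n (s * m) = ?T * (kron ?A z * ?T)"
  proof -
    have "upper_sign n (s * m) * amp n s P R y * lower_sign n (s * m)
        = (kron ?J (1\<^sub>m m) * ?T) * kron y (1\<^sub>m m) * (?T * kron ?L (1\<^sub>m m))"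
      using dT yd d by (simp add: signs_mult conj mult_assoc_dim)
    also have "\<dots> = ?T * (kron ?J ?p * kron y (1\<^sub>m m) * kron ?L ?r * ?T)"
      unfolding J L using dT yd d by (simp add: mult_assoc_dim)
    also have "kron ?J ?p * kron y (1\<^sub>m m) * kron ?L ?r = kron ?A z"
      using yd d by (simp add: kron_mult mult_one_dim z_def)
    finally show ?thesis .
  qed
  have 2: "mat_adjoint (amp n s P R y) = ?T * (kron (mat_adjoint y) (1\<^sub>m m) * ?T)"
    using dT yd d twist2_adjoint[OF P R]
    by (simp add: conj mat_adjoint_mult kron_adjoint mult_assoc_dim)
  have "sign_word n (s * m) (amp n s P R y)
      = ?T * (kron ?A z * (kron (mat_adjoint y) (1\<^sub>m m) * (kron ?A z * ?T)))"
    unfolding sign_word_def 1 2 using dT yd zd Ad by (simp add: mult_assoc_dim TT)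
  also have "\<dots> = ?T * (kron (?A * mat_adjoint y * ?A) (z * z) * ?T)"
  proof -
    have "kron (?A * mat_adjoint y * ?A) (z * z) = kron ?A z * (kron (mat_adjoint y) (1\<^sub>m m) * kron ?A z)"
      using yd zd by (simp add: kron_mult one_mult_dim mult_assoc_dim)
    then show ?thesis using dT yd zd Ad by (simp add: mult_assoc_dim)
  qed
  also have "\<dots> = (-1) \<cdot>\<^sub>m amp n s P R (sign_word n s y)"
  proof -
    have "dim_row (sign_word n s y) = 2 * n * s" "dim_col (sign_word n s y) = 2 * n * s"
      using yd by (auto simp: sign_word_def)
    then show ?thesis
      unfolding z using dT
      by (simp add: conj kron_smult_right smult_mult_dim mult_smult_dim flip: sign_word_def)
  qed
  finally show ?thesis .
qed

section \<open>Matrix units under regular maps\<close>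

lemma dim_unit_mat [simp]: "dim_row (unit_mat N i j) = N" "dim_col (unit_mat N i j) = N"
  by (simp_all add: unit_mat_def)

lemma unit_mat_carrier [simp]: "unit_mat N i j \<in> carrier_mat N N"
  by (simp add: unit_mat_def)

lemma unit_mat_mult: "j < N \<Longrightarrow> unit_mat N i j * unit_mat N j k = unit_mat N i k"
  by (intro eq_matI) (auto simp: unit_mat_def scalar_prod_def if_distrib[of "\<lambda>c. c * _"] cong: if_cong)

lemma unit_mat_adjoint: "mat_adjoint (unit_mat N i j) = unit_mat N j i"
  by (intro eq_matI) (auto simp: unit_mat_def)

lemma mult_unit_mat_adjoint:
  assumes "U \<in> carrier_mat N N" "k < N" "l < N"
  shows "U * unit_mat N k l * mat_adjoint U = mat N N (\<lambda>(a, b). U $$ (a, k) * cnj (U $$ (b, l)))"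
proof -
  have "U * unit_mat N k l = mat N N (\<lambda>(a, b). if b = l then U $$ (a, k) else 0)"
    using assms
    by (intro eq_matI)
      (auto simp: unit_mat_def scalar_prod_def if_distrib[of "\<lambda>c. _ * c"] cong: if_cong)
  then show ?thesis
    using assms
    by (intro eq_matI) (auto simp: scalar_prod_def if_distrib[of "\<lambda>c. c * _"] cong: if_cong)
qed

text \<open>With the single copy of \<open>x\<close> in the top left corner, the unit with indices k
  and l becomes column k of \<open>U\<close> times the adjoint of column l. One \<open>U\<close>
  serves all units of the domain algebra, so images of different units share their vectors.\<close>

lemma multiplicity_one_unit_mat:
  assumes "multiplicity_one n r s \<psi>"
  obtains U where "unitary_mat (2 * n * s) U" "2 * n * r \<le> 2 * n * s"
    "\<And>k l. k < 2 * n * r \<Longrightarrow> l < 2 * n * r \<Longrightarrow> unit_mat (2 * n * r) k l \<in> AG n r \<Longrightarrow>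
       \<psi> (unit_mat (2 * n * r) k l) = mat (2 * n * s) (2 * n * s) (\<lambda>(a, b). U $$ (a, k) * cnj (U $$ (b, l)))"
proof -
  let ?N = "2 * n * r" and ?M = "2 * n * s"
  obtain \<Psi> where \<Psi>: "star_extension (AG n r) (AG n s) \<psi> \<Psi>" "has_multiplicity ?N ?M 1 \<Psi>"
    using assms unfolding multiplicity_one_def by blast
  then obtain U d where M: "?M = ?N + d" and U: "unitary_mat ?M U"
    and \<Psi>U: "\<And>x. x \<in> carrier_mat ?N ?N \<Longrightarrow>
      \<Psi> x = U * diag_block_mat (replicate 1 x @ [0\<^sub>m d d]) * mat_adjoint U"
    unfolding has_multiplicity_def by auto
  have "\<psi> (unit_mat ?N k l) = mat ?M ?M (\<lambda>(a, b). U $$ (a, k) * cnj (U $$ (b, l)))"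
    if "k < ?N" "l < ?N" "unit_mat ?N k l \<in> AG n r" for k l
  proof -
    have "diag_block_mat (replicate 1 (unit_mat ?N k l) @ [0\<^sub>m d d]) = unit_mat ?M k l"
      unfolding M using that by (intro eq_matI) (auto simp: unit_mat_def)
    moreover have "\<psi> (unit_mat ?N k l) = \<Psi> (unit_mat ?N k l)"
      using \<Psi>(1) that(3) by (auto simp: star_extension_def)
    ultimately show ?thesis
      using \<Psi>U[of "unit_mat ?N k l"] U that M
      by (simp add: mult_unit_mat_adjoint unitary_mat_def del: assoc_mult_mat)
  qed
  then show ?thesis using that[OF U] M by simp
qed

lemma foldr_add_index:
  assumes "\<And>A. A \<in> set As \<Longrightarrow> A \<in> carrier_mat N M" "i < N" "j < M"
  shows "foldr (+) As (0\<^sub>m N M :: complex mat) \<in> carrier_mat N M \<and>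
    foldr (+) As (0\<^sub>m N M) $$ (i, j) = (\<Sum>k<length As. (As ! k) $$ (i, j))"
  using assms
proof (induction As)
  case (Cons A As)
  then show ?case by (auto simp: sum.lessThan_Suc_shift simp del: sum.lessThan_Suc)
qed auto

lemma foldr_add_carrier:
  assumes "\<And>A. A \<in> set As \<Longrightarrow> A \<in> carrier_mat N M"
  shows "foldr (+) As (0\<^sub>m N M :: complex mat) \<in> carrier_mat N M"
  using assms by (induction As) auto

lemma unit_mat_AG:
  assumes "0 < r" "k < 2 * n * r" "l < 2 * n * r" "(k div r, l div r) \<in> G_edges n"
  shows "unit_mat (2 * n * r) k l \<in> AG n r"
  using assms unfolding AG_iff[OF assms(1)] by (auto simp: unit_mat_def)

text \<open>
  Self-adjoint elements of \<open>A(G\<^sub>n) \<otimes> M\<^sub>s\<close> are block diagonal.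
\<close>

lemma rank_one_AG_support:
  assumes s: "0 < s" and AG: "mat (2 * n * s) (2 * n * s) (\<lambda>(a, b). v a * cnj (v b)) \<in> AG n s"
  shows "\<exists>i. \<forall>a<2 * n * s. v a \<noteq> 0 \<longrightarrow> a div s = i"
proof -
  have "a div s = b div s" if "a < 2 * n * s" "b < 2 * n * s" "v a \<noteq> 0" "v b \<noteq> 0" for a b
  proof -
    have "(a div s, b div s) \<in> G_edges n" "(b div s, a div s) \<in> G_edges n"
      using AG that unfolding AG_iff[OF s] by force+
    then show ?thesis by (auto simp: G_edges_def)
  qed
  then show ?thesis by metis
qed

text \<open>Summand i sends the chosen edge unit to v_i w_i^*. The v_i form the columns of
  \<open>V\<close> and the w_i those of \<open>W\<close>; orthogonality of the summands makes both
  isometries. Each v_i lives at a single vertex \<open>f i\<close> and each w_i at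
  \<open>g i\<close>, so functions of the vertex act on the columns as real scalars.\<close>

lemma regular_unit_mat_factorization:
  assumes n: "0 < n" and r: "0 < r" and s: "0 < s" and reg: "regular n r s \<phi>"
  obtains N V W f g where "V \<in> carrier_mat (2 * n * s) N" "W \<in> carrier_mat (2 * n * s) N"
    "mat_adjoint V * V = 1\<^sub>m N" "mat_adjoint W * W = 1\<^sub>m N"
    "\<phi> (unit_mat (2 * n * r) 0 (n * r)) = V * mat_adjoint W"
    "\<And>h. real_diag (2 * n * s) (\<lambda>a. h (a div s)) * V = V * real_diag N (\<lambda>i. h (f i))"
    "\<And>h. real_diag (2 * n * s) (\<lambda>a. h (a div s)) * W = W * real_diag N (\<lambda>i. h (g i))"
proof -
  let ?N = "2 * n * r" and ?M = "2 * n * s"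
  obtain \<psi>s where sum: "direct_sum_of n r s \<phi> \<psi>s" and mult: "\<forall>\<psi>\<in>set \<psi>s. multiplicity_one n r s \<psi>"
    using reg unfolding regular_def by blast
  define L where "L = length \<psi>s"
  have less: "0 < ?N" "n * r < ?N" using n r by auto
  have AG: "unit_mat ?N 0 0 \<in> AG n r" "unit_mat ?N 0 (n * r) \<in> AG n r"
    "unit_mat ?N (n * r) (n * r) \<in> AG n r"
    using n r less by (auto intro!: unit_mat_AG simp: G_edges_def)
  have "\<forall>i<L. \<exists>U. unitary_mat ?M U \<and> ?N \<le> ?M \<and>
      (\<forall>k l. k < ?N \<longrightarrow> l < ?N \<longrightarrow> unit_mat ?N k l \<in> AG n r \<longrightarrow>
        (\<psi>s ! i) (unit_mat ?N k l) = mat ?M ?M (\<lambda>(a, b). U $$ (a, k) * cnj (U $$ (b, l))))"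
    using mult multiplicity_one_unit_mat unfolding L_def by (metis nth_mem)
  then obtain U where U: "\<And>i. i < L \<Longrightarrow> unitary_mat ?M (U i)" "\<And>i. i < L \<Longrightarrow> ?N \<le> ?M"
    and \<psi>: "\<And>i k l. i < L \<Longrightarrow> k < ?N \<Longrightarrow> l < ?N \<Longrightarrow> unit_mat ?N k l \<in> AG n r \<Longrightarrow>
      (\<psi>s ! i) (unit_mat ?N k l) = mat ?M ?M (\<lambda>(a, b). U i $$ (a, k) * cnj (U i $$ (b, l)))"
    by metis
  \<comment> \<open>Column i of \<open>C k\<close> is column k of the unitary of summand i. The
    number \<open>N\<close> of the statement is thus the number of summands, with \<open>V\<close>
    and \<open>W\<close> the cases k = 0 and k = n * r, the two ends of the edge.\<close>
  define C where "C k = mat ?M L (\<lambda>(a, i). U i $$ (a, k))" for k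
  have isometry: "mat_adjoint (C k) * C k = 1\<^sub>m L"
    and diag: "\<exists>f. \<forall>h. real_diag ?M (\<lambda>a. h (a div s)) * C k = C k * real_diag L (\<lambda>i. h (f i))"
    if k: "k < ?N" and E: "unit_mat ?N k k \<in> AG n r" for k
  proof -
    have unit: "(\<Sum>a = 0..<?M. cnj (U i $$ (a, k)) * U i $$ (a, k)) = 1" if i: "i < L" for i
    proof -
      have "k < ?M" using k U(2)[OF i] by (rule less_le_trans)
      have Uc: "U i \<in> carrier_mat ?M ?M" and UU: "mat_adjoint (U i) * U i = 1\<^sub>m ?M"
        using U(1)[OF i] by (auto simp: unitary_mat_def)
      have "(mat_adjoint (U i) * U i) $$ (k, k) = (\<Sum>a = 0..<?M. cnj (U i $$ (a, k)) * U i $$ (a, k))"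
        using Uc \<open>k < ?M\<close> by (simp add: scalar_prod_def)
      then show ?thesis unfolding UU using \<open>k < ?M\<close> by simp
    qed
    \<comment> \<open>The product of the rank one projections onto the k-th columns of two summands
      is their inner product times a nonzero matrix, and it vanishes because the summands are
      orthogonal.\<close>
    have orth: "(\<Sum>a = 0..<?M. cnj (U i $$ (a, k)) * U j $$ (a, k)) = 0"
      if ij: "i < L" "j < L" "i \<noteq> j" for i j
    proof -
      let ?c = "\<Sum>a = 0..<?M. cnj (U i $$ (a, k)) * U j $$ (a, k)"
      have "(\<psi>s ! i) (unit_mat ?N k k) * (\<psi>s ! j) (unit_mat ?N k k) = 0\<^sub>m ?M ?M"
        using sum ij E unfolding direct_sum_of_def L_def by blast
      note prod = this
      have "U i $$ (a, k) * ?c * cnj (U j $$ (b, k)) = 0" if ab: "a < ?M" "b < ?M" for a b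
      proof -
        have "U i $$ (a, k) * ?c * cnj (U j $$ (b, k)) = (\<Sum>t = 0..<?M.
            U i $$ (a, k) * cnj (U i $$ (t, k)) * (U j $$ (t, k) * cnj (U j $$ (b, k))))"
          by (simp add: sum_distrib_left sum_distrib_right mult.assoc)
        also have "\<dots> = ((\<psi>s ! i) (unit_mat ?N k k) * (\<psi>s ! j) (unit_mat ?N k k)) $$ (a, b)"
          using ab by (simp add: \<psi>[OF ij(1) k k E] \<psi>[OF ij(2) k k E] scalar_prod_def)
        finally show ?thesis unfolding prod using ab by simp
      qed
      note zero = this
      have "\<exists>a<?M. U i $$ (a, k) \<noteq> 0" if "i < L" for i
      proof (rule ccontr)
        assume "\<not> ?thesis"
        then show False using unit[OF that] by simp
      qed
      then obtain a b where "a < ?M" "U i $$ (a, k) \<noteq> 0" "b < ?M" "U j $$ (b, k) \<noteq> 0"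
        using ij(1,2) by blast
      then show ?thesis using zero[of a b] by simp
    qed
    show "mat_adjoint (C k) * C k = 1\<^sub>m L"
      using unit orth by (intro eq_matI) (auto simp: C_def scalar_prod_def)
    \<comment> \<open>A diagonal unit goes to the self-adjoint matrix u u^*, which lies in the range
      algebra; this confines u to a single vertex.\<close>
    have "\<exists>v. \<forall>a<?M. U i $$ (a, k) \<noteq> 0 \<longrightarrow> a div s = v" if i: "i < L" for i
    proof (rule rank_one_AG_support[OF s])
      have "multiplicity_one n r s (\<psi>s ! i)" using mult i by (simp add: L_def)
      then have "(\<psi>s ! i) (unit_mat ?N k k) \<in> AG n s"
        using E unfolding multiplicity_one_def by blast
      then show "mat ?M ?M (\<lambda>(a, b). U i $$ (a, k) * cnj (U i $$ (b, k))) \<in> AG n s"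
        unfolding \<psi>[OF i k k E] .
    qed
    then obtain f where f: "\<And>i a. i < L \<Longrightarrow> a < ?M \<Longrightarrow> U i $$ (a, k) \<noteq> 0 \<Longrightarrow> a div s = f i"
      by metis
    have "real_diag ?M (\<lambda>a. h (a div s)) * C k = C k * real_diag L (\<lambda>i. h (f i))" for h
    proof -
      have "complex_of_real (h (a div s)) * U i $$ (a, k) = U i $$ (a, k) * complex_of_real (h (f i))"
        if "i < L" "a < ?M" for i a
        using f[OF that] by (cases "U i $$ (a, k) = 0") auto
      moreover have Ck: "C k \<in> carrier_mat ?M L" by (simp add: C_def)
      ultimately show ?thesis
        unfolding real_diag_mult_left[OF Ck] mult_real_diag_right[OF Ck]
        by (intro eq_matI) (auto simp: C_def)
    qed
    then show "\<exists>f. \<forall>h. real_diag ?M (\<lambda>a. h (a div s)) * C k = C k * real_diag L (\<lambda>i. h (f i))"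
      by blast
  qed
  let ?As = "map (\<lambda>\<psi>. \<psi> (unit_mat ?N 0 (n * r))) \<psi>s"
  have \<psi>E: "(\<psi>s ! i) (unit_mat ?N 0 (n * r)) = mat ?M ?M (\<lambda>(a, b). U i $$ (a, 0) * cnj (U i $$ (b, n * r)))"
    if "i < L" for i
    by (rule \<psi>[OF that less AG(2)])
  have As: "A \<in> carrier_mat ?M ?M" if "A \<in> set ?As" for A
    using that \<psi>E by (auto simp: in_set_conv_nth L_def)
  have As_sum: "foldr (+) ?As (0\<^sub>m ?M ?M) \<in> carrier_mat ?M ?M"
    by (rule foldr_add_carrier) (rule As)
  have "\<phi> (unit_mat ?N 0 (n * r)) = foldr (+) ?As (0\<^sub>m ?M ?M)"
    using sum AG(2) unfolding direct_sum_of_def by blast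
  also have "\<dots> = C 0 * mat_adjoint (C (n * r))"
  proof (rule eq_matI)
    fix a b assume "a < dim_row (C 0 * mat_adjoint (C (n * r)))" "b < dim_col (C 0 * mat_adjoint (C (n * r)))"
    then have ab: "a < ?M" "b < ?M" by (auto simp: C_def)
    have "foldr (+) ?As (0\<^sub>m ?M ?M) $$ (a, b) = (\<Sum>i<L. (?As ! i) $$ (a, b))"
      using foldr_add_index[of ?As ?M ?M a b, OF As ab] by (simp add: L_def)
    also have "\<dots> = (\<Sum>i<L. U i $$ (a, 0) * cnj (U i $$ (b, n * r)))"
      using ab \<psi>E by (intro sum.cong) (auto simp: L_def)
    finally show "foldr (+) ?As (0\<^sub>m ?M ?M) $$ (a, b) = (C 0 * mat_adjoint (C (n * r))) $$ (a, b)"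
      using ab by (simp add: C_def scalar_prod_def lessThan_atLeast0)
  qed (use As_sum in \<open>auto simp: C_def\<close>)
  finally have y: "\<phi> (unit_mat ?N 0 (n * r)) = C 0 * mat_adjoint (C (n * r))" .
  obtain f g where
    fg: "\<And>h. real_diag ?M (\<lambda>a. h (a div s)) * C 0 = C 0 * real_diag L (\<lambda>i. h (f i))"
    "\<And>h. real_diag ?M (\<lambda>a. h (a div s)) * C (n * r) = C (n * r) * real_diag L (\<lambda>i. h (g i))"
    using diag[OF less(1) AG(1)] diag[OF less(2) AG(3)] by blast
  have Ck: "C k \<in> carrier_mat ?M L" for k by (simp add: C_def)
  show ?thesis
    by (rule that[OF Ck Ck isometry[OF less(1) AG(1)] isometry[OF less(2) AG(3)] y fg])
qed

text \<open>On y = V W^* the signs become a real diagonal matrix D between \<open>V\<close> and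
  \<open>W^*\<close>, and the isometries turn the word into V D^2 W^*. Equality with -y would force
  D^2 = -1.\<close>

lemma regular_sign_word:
  assumes n: "0 < n" and r: "0 < r" and s: "0 < s" and reg: "regular n r s \<phi>"
    and word: "sign_word n s (\<phi> (unit_mat (2 * n * r) 0 (n * r)))
      = (-1) \<cdot>\<^sub>m \<phi> (unit_mat (2 * n * r) 0 (n * r))"
  shows "\<phi> (unit_mat (2 * n * r) 0 (n * r)) = 0\<^sub>m (2 * n * s) (2 * n * s)"
proof -
  let ?M = "2 * n * s"
  obtain N V W f g where Vc: "V \<in> carrier_mat ?M N" and Wc: "W \<in> carrier_mat ?M N"
    and V: "mat_adjoint V * V = 1\<^sub>m N" and W: "mat_adjoint W * W = 1\<^sub>m N"
    and y: "\<phi> (unit_mat (2 * n * r) 0 (n * r)) = V * mat_adjoint W"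
    and f: "\<And>h. real_diag ?M (\<lambda>a. h (a div s)) * V = V * real_diag N (\<lambda>i. h (f i))"
    and g: "\<And>h. real_diag ?M (\<lambda>a. h (a div s)) * W = W * real_diag N (\<lambda>i. h (g i))"
    by (rule regular_unit_mat_factorization[OF n r s reg]) (rule that)
  have d: "dim_row V = ?M" "dim_col V = N" "dim_row W = ?M" "dim_col W = N" using Vc Wc by auto
  define p q where "p i = (if f i < n then pair_sign (f i) else 0)"
    and "q i = (if n \<le> g i then pair_sign (g i - n) else 0)" for i
  have p: "upper_sign n s * V = V * real_diag N p"
    unfolding upper_sign_def kron_real_diag_one p_def[abs_def]
    by (rule f[of "\<lambda>i. if i < n then pair_sign i else 0"])
  have q: "lower_sign n s * W = W * real_diag N q"
    unfolding lower_sign_def kron_real_diag_one q_def[abs_def]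
    by (rule g[of "\<lambda>i. if n \<le> i then pair_sign (i - n) else 0"])
  have "mat_adjoint (lower_sign n s * W) = mat_adjoint (W * real_diag N q)" using q by simp
  then have q': "mat_adjoint W * lower_sign n s = real_diag N q * mat_adjoint W"
    using d by (simp add: mat_adjoint_mult lower_sign_def kron_adjoint)
  let ?D = "real_diag N (\<lambda>i. p i * q i)"
  have A: "upper_sign n s * (V * mat_adjoint W) * lower_sign n s = V * (?D * mat_adjoint W)"
  proof -
    have "upper_sign n s * (V * mat_adjoint W) * lower_sign n s
        = (upper_sign n s * V) * (mat_adjoint W * lower_sign n s)"
      using d by (simp add: mult_assoc_dim)
    also have "\<dots> = V * ((real_diag N p * real_diag N q) * mat_adjoint W)"
      unfolding p q' using d by (simp add: mult_assoc_dim)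
    finally show ?thesis unfolding real_diag_mult .
  qed
  have VV: "mat_adjoint V * (V * B) = B" and WW: "mat_adjoint W * (W * B) = B" if "dim_row B = N" for B
    using that d mult_assoc_dim[of "mat_adjoint V" V B] mult_assoc_dim[of "mat_adjoint W" W B]
    by (simp_all add: V W one_mult_dim)
  have "sign_word n s (V * mat_adjoint W) = V * (?D * (?D * mat_adjoint W))"
    unfolding sign_word_def A using d by (simp add: mat_adjoint_mult mult_assoc_dim VV WW)
  then have "V * (?D * (?D * mat_adjoint W)) = (-1) \<cdot>\<^sub>m (V * mat_adjoint W)"
    using word unfolding y by simp
  \<comment> \<open>Compressing with the two isometries removes them and leaves an equation between
    N by N diagonal matrices.\<close>
  then have "mat_adjoint V * (V * (?D * (?D * mat_adjoint W))) * W
      = mat_adjoint V * ((-1) \<cdot>\<^sub>m (V * mat_adjoint W)) * W" by simp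
  then have "?D * ?D = (-1) \<cdot>\<^sub>m 1\<^sub>m N"
    using d by (simp add: VV mult_assoc_dim W mult_one_dim mult_smult_dim smult_mult_dim V)
  then have D: "(?D * ?D) $$ (i, i) = -1" if "i < N" for i using that by simp
  \<comment> \<open>A diagonal entry of D^2 is the square of a real number and cannot be -1, so
    there is no column, hence no summand, at all.\<close>
  have "N = 0"
  proof (rule ccontr)
    assume "N \<noteq> 0"
    then have "complex_of_real ((p 0 * q 0) * (p 0 * q 0)) = complex_of_real (-1)"
      using D[of 0] unfolding real_diag_mult by (simp add: real_diag_def)
    then have "(p 0 * q 0) * (p 0 * q 0) = -1" by (simp only: of_real_eq_iff)
    then show False using zero_le_square[of "p 0 * q 0"] by linarith
  qed
  then show ?thesis
    unfolding y using d by (intro eq_matI) (auto simp: scalar_prod_def)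
qed

section \<open>Following the sign through the direct system\<close>

definition sign_eigen :: "nat \<Rightarrow> nat \<Rightarrow> complex \<Rightarrow> complex mat \<Rightarrow> bool" where
  "sign_eigen n s c y \<longleftrightarrow> y \<in> carrier_mat (2 * n * s) (2 * n * s) \<and>
     y \<noteq> 0\<^sub>m (2 * n * s) (2 * n * s) \<and> sign_word n s y = c \<cdot>\<^sub>m y"

text \<open>The unit E joins the first vertices of the two halves, where both signs are 1, so the
  word reduces to E E^* E = E.\<close>

lemma sign_eigen_unit_mat:
  assumes "0 < n" "0 < s"
  shows "sign_eigen n s 1 (unit_mat (2 * n * s) 0 (n * s))"
proof -
  let ?E = "unit_mat (2 * n * s) 0 (n * s)"
  have less: "0 < 2 * n * s" "n * s < 2 * n * s" using assms by auto
  have "upper_sign n s * ?E = ?E"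
    unfolding upper_sign_def kron_real_diag_one
    using assms by (subst real_diag_mult_left[OF unit_mat_carrier])
      (intro eq_matI, auto simp: unit_mat_def pair_sign_def)
  moreover have "?E * lower_sign n s = ?E"
    unfolding lower_sign_def kron_real_diag_one
    using assms by (subst mult_real_diag_right[OF unit_mat_carrier])
      (intro eq_matI, auto simp: unit_mat_def pair_sign_def)
  ultimately have "sign_word n s ?E = ?E"
    using less by (simp add: sign_word_def unit_mat_adjoint unit_mat_mult)
  moreover have "?E \<noteq> 0\<^sub>m (2 * n * s) (2 * n * s)"
  proof
    assume "?E = 0\<^sub>m (2 * n * s) (2 * n * s)"
    then have "?E $$ (0, n * s) = 0" using less by simp
    then show False using less by (simp add: unit_mat_def)
  qed
  moreover have "1 \<cdot>\<^sub>m ?E = ?E" by (intro eq_matI) auto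
  ultimately show ?thesis by (simp add: sign_eigen_def)
qed

lemma sign_eigen_amp:
  assumes n: "2 \<le> n" and y: "sign_eigen n s c y"
  shows "sign_eigen n (s * 2) (- c) (amp n s diag_proj flat_proj y)"
proof -
  let ?P = diag_proj and ?R = flat_proj
  note PR = projection_diag_proj projection_flat_proj
  note d = projectionD[OF PR(1)] projectionD[OF PR(2)]
  let ?z = "(?P - compl ?P) * (?R - compl ?R)"
  have yc: "y \<in> carrier_mat (2 * n * s) (2 * n * s)" and y0: "y \<noteq> 0\<^sub>m (2 * n * s) (2 * n * s)"
    and word: "sign_word n s y = c \<cdot>\<^sub>m y"
    using y by (auto simp: sign_eigen_def)
  \<comment> \<open>The product of diag(1, -1) with the coordinate interchange is a quarter turn,
    whose square is -1.\<close>
  have "?z = mat 2 2 (\<lambda>(i, j). if i = j then 0 else if i = 0 then 1 else -1)"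
    by (intro eq_matI)
      (auto simp: diag_proj_def flat_proj_def scalar_prod_def numeral_2_eq_2 less_Suc_eq)
  then have z: "?z * ?z = (-1) \<cdot>\<^sub>m 1\<^sub>m 2"
    by (simp only:, intro eq_matI) (auto simp: scalar_prod_def numeral_2_eq_2 less_Suc_eq)
  have "sign_word n (s * 2) (amp n s ?P ?R y) = (-1) \<cdot>\<^sub>m amp n s ?P ?R (c \<cdot>\<^sub>m y)"
    using sign_word_amp[OF n PR yc z] unfolding word .
  also have "\<dots> = (- c) \<cdot>\<^sub>m amp n s ?P ?R y"
    using star_hom_amp[OF n PR, of s] yc unfolding star_hom_def
    by (auto intro!: eq_matI)
  finally have "sign_word n (s * 2) (amp n s ?P ?R y) = (- c) \<cdot>\<^sub>m amp n s ?P ?R y" .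
  moreover have ac: "amp n s ?P ?R y \<in> carrier_mat (2 * n * s * 2) (2 * n * s * 2)"
    by (rule amp_carrier[OF PR yc])
  \<comment> \<open>Nonvanishing must be carried along, since \<open>regular_sign_word\<close> only
    concludes that the image is zero. Conjugating again recovers y \<otimes> 1, and its entries at
    even indices are those of \<open>y\<close>.\<close>
  moreover have "amp n s ?P ?R y \<noteq> 0\<^sub>m (2 * n * s * 2) (2 * n * s * 2)"
  proof
    let ?T = "twist2 n s ?P ?R" and ?N = "2 * n * s * 2"
    assume zero: "amp n s ?P ?R y = 0\<^sub>m ?N ?N"
    have dT: "dim_row ?T = ?N" "dim_col ?T = ?N" using d by (simp_all add: dim_twist2[of _ 2])
    have T2: "?T * ?T = 1\<^sub>m ?N" by (rule twist2_square[OF n PR])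
    have "?T * (?T * A) = A" if "dim_row A = ?N" for A
      using that dT mult_assoc_dim[of ?T ?T A] by (simp add: T2 one_mult_dim)
    then have "?T * amp n s ?P ?R y * ?T = kron y (1\<^sub>m 2)"
      using yc dT d by (auto simp: amp_def mult_assoc_dim T2 mult_one_dim)
    moreover have "?T * 0\<^sub>m ?N ?N * ?T = 0\<^sub>m ?N ?N"
      using dT by (simp add: mult_zero_dim zero_mult_dim)
    ultimately have k: "kron y (1\<^sub>m 2) = 0\<^sub>m ?N ?N" unfolding zero by simp
    have "y $$ (i, j) = 0" if "i < 2 * n * s" "j < 2 * n * s" for i j
    proof -
      have "kron y (1\<^sub>m 2) $$ (i * 2, j * 2) = 0" using that unfolding k by simp
      then show ?thesis using that yc by auto
    qed
    then have "y = 0\<^sub>m (2 * n * s) (2 * n * s)" using yc by (intro eq_matI) auto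
    with y0 show False by simp
  qed
  ultimately show ?thesis by (simp add: sign_eigen_def mult.assoc)
qed

lemma double_amp_eq:
  assumes "2 \<le> n" "x \<in> carrier_mat (2 * n * s) (2 * n * s)"
  shows "double_amp n s x = amp n (s * 2) diag_proj flat_proj (amp n s diag_proj flat_proj x)"
  unfolding double_amp_def
  by (rule amp_amp[symmetric]) (use assms projection_diag_proj projection_flat_proj in auto)

text \<open>Every connecting map is the composition of two basic maps, and their two sign changes
  cancel.\<close>

lemma sign_eigen_link:
  assumes n: "2 \<le> n" and x: "sign_eigen n (4 ^ i) 1 x" and le: "i \<le> j"
  shows "sign_eigen n (4 ^ j) 1 (link (\<lambda>k. double_amp n (4 ^ k)) i j x)"
  using le
proof (induction j rule: dec_induct)
  case base
  then show ?case using x by (simp add: link_def)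
next
  case (step j)
  let ?y = "link (\<lambda>k. double_amp n (4 ^ k)) i j x"
  have "link (\<lambda>k. double_amp n (4 ^ k)) i (Suc j) x = double_amp n (4 ^ j) ?y"
    using step.hyps by (simp add: link_def)
  moreover have "sign_eigen n (4 ^ j * 2 * 2) (- (- 1)) (double_amp n (4 ^ j) ?y)"
    using step.IH sign_eigen_amp[OF n sign_eigen_amp[OF n step.IH]] double_amp_eq[OF n]
    by (simp add: sign_eigen_def)
  ultimately show ?case by (simp add: mult.commute)
qed

lemma star_extendible_amp:
  assumes n: "2 \<le> n" and s: "0 < s"
  shows "star_extendible (AG n s) (AG n (s * 2)) (amp n s diag_proj flat_proj)"
proof -
  note PR = projection_diag_proj projection_flat_proj
  have AG: "amp n s diag_proj flat_proj \<in> AG n s \<rightarrow> AG n (s * 2)"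
    using s by (intro block_preserving_AG block_preserving_amp[OF n s _ PR]) auto
  have sub: "AG n s \<subseteq> carrier_mat (2 * n * s) (2 * n * s)" by (auto simp: AG_def ampl_def)
  show ?thesis
    unfolding star_extendible_def
    using AG star_extension_of_star_hom[OF star_hom_amp[OF n PR] sub AG] by blast
qed

text \<open>\<open>family_F\<close> hides its sizes behind existential quantifiers, so they have to
  be recovered from the algebras; the dimension of a zero matrix suffices.\<close>

lemma AG_inj:
  assumes "0 < n" "AG n r = AG n s"
  shows "r = s"
proof -
  have "0\<^sub>m (2 * n * r) (2 * n * r) \<in> AG n r"
    unfolding AG_def ampl_def digraph_alg_def
    by (auto simp: mult_add_less_mult)
  then have "0\<^sub>m (2 * n * r) (2 * n * r) \<in> AG n s" using assms by simp
  then show ?thesis using assms(1) by (auto simp: AG_def ampl_def)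
qed

text \<open>\<open>F\<close> is any family between the two: its connecting maps are supplied by the
  smaller one, and the contradiction needs only membership of a crossover map in the larger
  one.\<close>

lemma not_functorial:
  assumes n: "2 \<le> n"
    and F: "\<And>A B \<phi>. F A B \<phi> \<Longrightarrow> family_F n A B \<phi>" and G: "\<And>A B \<phi>. family_G n A B \<phi> \<Longrightarrow> F A B \<phi>"
  shows "\<not> functorial F"
proof
  assume funct: "functorial F"
  \<comment> \<open>The basic map doubles the size and every connecting map is its square: hence
    sizes 4^k in the first system and 2 * 4^k in the interlaced one.\<close>
  define A where "A k = AG n (4 ^ k)" for k
  define A' where "A' k = AG n (4 ^ k * 2)" for k
  define \<phi> where "\<phi> k = double_amp n (4 ^ k)" for k
  define \<phi>' where "\<phi>' k = double_amp n (4 ^ k * 2)" for k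
  define \<alpha> where "\<alpha> k = amp n (4 ^ k) diag_proj flat_proj" for k
  define \<beta> where "\<beta> k = amp n (4 ^ k * 2) diag_proj flat_proj" for k
  have pow: "4 ^ Suc k = 4 ^ k * (4 :: nat)" "4 ^ k * 2 * 2 = (4 ^ Suc k :: nat)"
    "4 ^ Suc k * 2 = 4 ^ k * 2 * (4 :: nat)" for k by simp_all
  have car: "x \<in> carrier_mat (2 * n * s) (2 * n * s)" if "x \<in> AG n s" for x s
    using that by (auto simp: AG_def ampl_def)
  have "F (A k) (A (Suc k)) (\<phi> k)" for k
    unfolding A_def \<phi>_def pow(1) by (intro G family_G_double_amp n) simp
  moreover have "F (A' k) (A' (Suc k)) (\<phi>' k)" for k
    unfolding A'_def \<phi>'_def pow(3) by (intro G family_G_double_amp n) simp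
  moreover have "star_extendible (A k) (A' k) (\<alpha> k)" for k
    unfolding A_def A'_def \<alpha>_def by (rule star_extendible_amp[OF n]) simp
  moreover have "star_extendible (A' k) (A (Suc k)) (\<beta> k)" for k
    unfolding A_def A'_def \<beta>_def pow(2)[symmetric] by (rule star_extendible_amp[OF n]) simp
  moreover have "\<forall>x\<in>A k. \<beta> k (\<alpha> k x) = \<phi> k x" for k
    unfolding A_def \<alpha>_def \<beta>_def \<phi>_def using double_amp_eq[OF n car] by simp
  moreover have "\<forall>x\<in>A' k. \<alpha> (Suc k) (\<beta> k x) = \<phi>' k x" for k
    unfolding A'_def \<alpha>_def \<beta>_def \<phi>'_def pow(2)[symmetric] using double_amp_eq[OF n car] by simp
  ultimately obtain p q where "\<forall>k. p k \<le> q k \<and> q k < p (Suc k)"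
    and "\<forall>k. F (A (p k)) (A' (q k)) (\<alpha> (q k) \<circ> link \<phi> (p k) (q k))"
    using funct[unfolded functorial_def, rule_format, of A \<phi> A' \<phi>' \<alpha> \<beta>] by blast
  \<comment> \<open>A single crossover map from the first system to the second is enough: it is a
    composition of 2 * (j - i) + 1 basic maps, an odd number.\<close>
  then obtain i j where ij: "i \<le> j" and "F (A i) (A' j) (\<alpha> j \<circ> link \<phi> i j)" by blast
  then have "family_F n (A i) (A' j) (\<alpha> j \<circ> link \<phi> i j)" by (blast intro: F)
  then obtain r s where rs: "A i = AG n r" "A' j = AG n s" "regular n r s (\<alpha> j \<circ> link \<phi> i j)"
    unfolding family_F_def by blast
  have "r = 4 ^ i" "s = 4 ^ j * 2"
    using rs(1,2) n AG_inj[of n r "4 ^ i"] AG_inj[of n s "4 ^ j * 2"] by (auto simp: A_def A'_def)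
  with rs(3) have reg: "regular n (4 ^ i) (4 ^ j * 2) (\<alpha> j \<circ> link \<phi> i j)" by simp
  define y where "y = (\<alpha> j \<circ> link \<phi> i j) (unit_mat (2 * n * 4 ^ i) 0 (n * 4 ^ i))"
  have "sign_eigen n (4 ^ i) 1 (unit_mat (2 * n * 4 ^ i) 0 (n * 4 ^ i))"
    using n by (intro sign_eigen_unit_mat) auto
  then have "sign_eigen n (4 ^ j * 2) (- 1) y"
    unfolding y_def \<alpha>_def \<phi>_def comp_def by (intro sign_eigen_amp[OF n] sign_eigen_link[OF n _ ij])
  then have "sign_word n (4 ^ j * 2) y = (-1) \<cdot>\<^sub>m y"
    and "y \<noteq> 0\<^sub>m (2 * n * (4 ^ j * 2)) (2 * n * (4 ^ j * 2))"
    by (auto simp: sign_eigen_def)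
  then show False
    using regular_sign_word[OF _ _ _ reg] n unfolding y_def by simp
qed

theorem theorem11p2:
  fixes n :: nat
  assumes "2 \<le> n"
  shows "\<not> functorial (family_F n) \<and> \<not> functorial (family_G n)"
proof
  show "\<not> functorial (family_F n)"
    by (rule not_functorial[OF assms]) (auto simp: family_G_def)
  show "\<not> functorial (family_G n)"
    by (rule not_functorial[OF assms]) (auto simp: family_G_def)
qed

end
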